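(* Let $k\in\mathbb{N}=\{1,2,3,\dots\}$ and $M\in\mathbb{R}$, and let $\mathcal{M}_{k,M}$ be the family of all meromorphic functions $f$ on the unit disk $\mathbb{D}$ with $\Vert S_k(f)\Vert_\infty\le M$, where $S_k(f)$ is the generalized Schwarzian derivative of order $k$. Then: (i) the family $\{f''/f' : f\in\mathcal{M}_{k,M}\}$ is quasi-normal on $\mathbb{D}$, and no sequence in this family converges to $\infty$; (ii) the family $\{f'/f : f\in\mathcal{M}_{k,M}\}$ is quasi-normal on $\mathbb{D}$, and no sequence in this family converges to $\infty$; (iii) the family $\{f' : f\in\mathcal{M}_{k,M}\}$ is quasi-normal on $\mathbb{D}$; (iv) the family $\mathcal{M}_{k,M}$ is quasi-normal on $\mathbb{D}$. Here a sequence "converges to $\infty$" if there is a set $E\subseteq\mathbb{D}$ without accumulation point in $\mathbb{D}$ such that the sequence converges to the constant $\infty$ locally uniformly on $\mathbb{D}\setminus E$.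
   Context: $\mathbb{D}=\{z\in\mathbb{C}:|z|<1\}$. Generalized Schwarzian derivative: for a non-constant meromorphic function $f$ on $\mathbb{D}$ and $n\in\mathbb{N}$, put $S_{2,n}(f):=f''/f'$ and, for $k\ge 2$, $S_{k+1,n}(f):=\big(S_{k,n}(f)\big)'-\frac1n\frac{f''}{f'}\,S_{k,n}(f)$ (as meromorphic functions on $\mathbb{D}$). For $k\in\mathbb{N}$ define $S_k(f):=S_{k+1,k}(f)$. (So $S_1(f)=f''/f'$ and $S_2(f)$ is the classical Schwarzian.) For constant functions $c$ one sets $S_k(c)\equiv\infty$; in particular no constant function belongs to $\mathcal{M}_{k,M}$. $\Vert\cdot\Vert_\infty$ is the supremum norm on $\mathbb{D}$; the condition $\Vert S_k(f)\Vert_\infty\le M$ entails that the meromorphic function $S_k(f)$ has no poles in $\mathbb{D}$ (removable singularities being removed). A family $\mathcal{F}$ of meromorphic functions on a domain $D\subseteq\mathbb{C}$ is quasi-normal on $D$ if every sequence in $\mathcal{F}$ has a subsequence for which there is a set $E\subseteq D$ with no accumulation point in $D$ such that the subsequence converges locally uniformly on $D\setminus E$ with respect to the spherical metric (the limit $\equiv\infty$ is allowed). *)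

theory Defs
  imports "HOL-Complex_Analysis.Complex_Analysis"
begin

text \<open>
  The Riemann sphere is represented by \<^typ>\<open>complex option\<close>, with \<^const>\<open>None\<close> as the point at
  infinity (as in the library's \<^term>\<open>Alexandroff_compactification\<close>).

  The library predicate \<^term>\<open>f meromorphic_on A\<close> leaves the values of \<open>f\<close> at its singularities
  unspecified. The sphere-valued function below is what such an \<open>f\<close> denotes: infinity at the poles,
  the limit value everywhere else. In particular removable singularities are removed.
\<close>

definition sphere_value :: "(complex \<Rightarrow> complex) \<Rightarrow> complex \<Rightarrow> complex option" where
  "sphere_value f z = (if is_pole f z then None else Some (remove_sings f z))"

text \<open>
  The spherical metric is the great-circle distance on the unit sphere of
  \<^typ>\<open>complex \<times> real\<close>, transported by stereographic projection from the north pole.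
\<close>

definition stereographic :: "complex option \<Rightarrow> complex \<times> real" where
  "stereographic p =
    (case p of
      None \<Rightarrow> (0, 1)
    | Some z \<Rightarrow> (of_real (2 / (1 + (cmod z)\<^sup>2)) * z, ((cmod z)\<^sup>2 - 1) / ((cmod z)\<^sup>2 + 1)))"

definition spherical_dist :: "complex option \<Rightarrow> complex option \<Rightarrow> real" where
  "spherical_dist p q = arccos (stereographic p \<bullet> stereographic q)"

definition spherical_locally_uniform_limit ::
    "complex set \<Rightarrow> (nat \<Rightarrow> complex \<Rightarrow> complex option) \<Rightarrow> (complex \<Rightarrow> complex option) \<Rightarrow> bool" where
  "spherical_locally_uniform_limit U F g \<longleftrightarrow>
    (\<forall>z\<in>U. \<exists>r>0. \<forall>\<epsilon>>0. \<forall>\<^sub>F n in sequentially.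
      \<forall>w\<in>ball z r \<inter> U. spherical_dist (F n w) (g w) < \<epsilon>)"

definition no_accumulation_in :: "complex set \<Rightarrow> complex set \<Rightarrow> bool" where
  "no_accumulation_in E D \<longleftrightarrow> E \<subseteq> D \<and> (\<forall>z\<in>D. \<not> z islimpt E)"

text \<open>
  The limit \<open>g\<close> is an arbitrary sphere-valued function on \<open>D - E\<close>; the constant infinity is allowed.
\<close>

definition quasi_normal_on :: "(complex \<Rightarrow> complex) set \<Rightarrow> complex set \<Rightarrow> bool" where
  "quasi_normal_on \<F> D \<longleftrightarrow>
    (\<forall>f\<in>\<F>. f meromorphic_on D) \<and>
    (\<forall>F :: nat \<Rightarrow> complex \<Rightarrow> complex. range F \<subseteq> \<F> \<longrightarrow>
      (\<exists>s :: nat \<Rightarrow> nat. strict_mono s \<and>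
        (\<exists>E g. no_accumulation_in E D \<and>
          spherical_locally_uniform_limit (D - E) (\<lambda>n. sphere_value (F (s n))) g)))"

definition converges_to_infinity_on ::
    "(nat \<Rightarrow> complex \<Rightarrow> complex) \<Rightarrow> complex set \<Rightarrow> bool" where
  "converges_to_infinity_on F D \<longleftrightarrow>
    (\<exists>E. no_accumulation_in E D \<and>
      spherical_locally_uniform_limit (D - E) (\<lambda>n. sphere_value (F n)) (\<lambda>_. None))"

abbreviation unit_disk :: "complex set" where
  "unit_disk \<equiv> ball 0 1"

text \<open>
  \<open>S_aux n k f\<close> is $S_{k,n}(f)$, which is meaningful for \<open>k \<ge> 2\<close> only; the values at \<open>k < 2\<close> are
  fillers. All identities hold as identities of meromorphic functions, i.e. away from singularities.
\<close>

primrec S_aux :: "nat \<Rightarrow> nat \<Rightarrow> (complex \<Rightarrow> complex) \<Rightarrow> complex \<Rightarrow> complex" where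
  "S_aux n 0 f = (\<lambda>z. deriv (deriv f) z / deriv f z)"
| "S_aux n (Suc k) f =
    (if k < 2 then (\<lambda>z. deriv (deriv f) z / deriv f z)
     else (\<lambda>z. deriv (S_aux n k f) z
               - 1 / of_nat n * (deriv (deriv f) z / deriv f z) * S_aux n k f z))"

text \<open>
  For constant \<open>f\<close> the convention is that the derivative is identically infinite. Constancy is
  tested on the sphere-valued function, since the raw values of \<open>f\<close> at singularities are irrelevant.
\<close>

definition generalized_schwarzian :: "nat \<Rightarrow> (complex \<Rightarrow> complex) \<Rightarrow> complex \<Rightarrow> complex option" where
  "generalized_schwarzian k f =
    (if sphere_value f constant_on unit_disk then (\<lambda>_. None) else sphere_value (S_aux k (k + 1) f))"

definition disk_sup_norm :: "(complex \<Rightarrow> complex option) \<Rightarrow> ereal" where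
  "disk_sup_norm g =
    (SUP z\<in>unit_disk. case g z of None \<Rightarrow> \<infinity> | Some w \<Rightarrow> ereal (cmod w))"

definition schwarzian_family :: "nat \<Rightarrow> real \<Rightarrow> (complex \<Rightarrow> complex) set" where
  "schwarzian_family k M =
    {f. f meromorphic_on unit_disk \<and> disk_sup_norm (generalized_schwarzian k f) \<le> ereal M}"

end

theory Submission
  imports Defs
begin

text \<open>
  Put \<open>w = (f')\<close> to the power \<open>-1/k\<close>. Then \<open>S\<^sub>k(f) = - k w\<^sup>(\<^sup>k\<^sup>) / w\<close>, so \<open>w\<close> solves a linear
  differential equation of order \<open>k\<close> whose coefficient is holomorphic and bounded by \<open>M\<close>. Hence \<open>w\<close>
  is holomorphic on the whole disk, also where \<open>f'\<close> has poles, and it is bounded on compact sets by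
  its first \<open>k\<close> Taylor coefficients at the origin. After normalising these, Montel's theorem gives
  \<open>f\<^sub>n' = B\<^sub>n / V\<^sub>n\<^sup>k\<close> with \<open>V\<^sub>n\<close> converging to some \<open>V \<noteq> 0\<close>, which settles \<open>f''/f'\<close> and \<open>f'\<close> off
  the zeros of \<open>V\<close>. Integrating, \<open>f\<^sub>n = A\<^sub>n + B\<^sub>n G\<^sub>n\<close> with \<open>G\<^sub>n\<close> converging to a nonconstant \<open>G\<close> that is
  meromorphic on the disk. Dividing by \<open>N\<^sub>n = \<parallel>(A\<^sub>n, B\<^sub>n)\<parallel>\<close> gives the nonzero limit \<open>h = \<alpha> + \<beta> G\<close> of
  \<open>f\<^sub>n / N\<^sub>n\<close>, and this settles \<open>f'/f\<close> and \<open>f\<close> off the zeros of \<open>V\<close> and \<open>h\<close>.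
\<close>

section \<open>The spherical metric\<close>

text \<open>A k-th root of f' is multivalued in general, so it is formed only near the origin, and
  its Taylor series carries it to the disk. Then f' V^k is constant by the identity theorem, and no
  other singularity of f has to be examined. Three obstacles shape the rest. The disk without the
  zeros of V is not simply connected, so \<open>G\<close> cannot be obtained by integration; it is
  the limit of the single-valued functions (f_n - A_n) / B_n, whose convergence is propagated from
  one point. The zeros of h must not accumulate at a zero of V; an essential singularity of G would
  permit this, which is why G is shown to be meromorphic there. Finally, A_n and B_n may grow or
  decay at unrelated rates, so the pair is projected to the unit sphere, and only the scale N_n
  remains. For f''/f' the factor B_n cancels, for f'/f the scale N_n does, and so these two families
  have finite limits, whereas f_n = n z shows for M >= 0 that the other two may tend to
  infinity.\<close>

lemma stereographic_inner_Some:
  "stereographic (Some a) \<bullet> stereographic (Some b) =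
     1 - 2 * (cmod (a - b))\<^sup>2 / ((1 + (cmod a)\<^sup>2) * (1 + (cmod b)\<^sup>2))"
proof -
  define p where "p = 1 + (cmod a)\<^sup>2"
  define q where "q = 1 + (cmod b)\<^sup>2"
  have p: "p > 0" and q: "q > 0" unfolding p_def q_def by (simp_all add: add_pos_nonneg)
  have ab: "(cmod (a - b))\<^sup>2 = (cmod a)\<^sup>2 + (cmod b)\<^sup>2 - 2 * (a \<bullet> b)"
    by (simp add: power2_norm_eq_inner inner_diff_left inner_diff_right inner_commute)
  have "stereographic (Some a) \<bullet> stereographic (Some b)
      = (2 / p) * (2 / q) * (a \<bullet> b) + ((p - 2) / p) * ((q - 2) / q)"
    unfolding stereographic_def option.case scaleR_conv_of_real[symmetric]
    by (simp add: inner_prod_def p_def q_def add.commute)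
  also have "\<dots> = 1 - 2 * ((p - 1) + (q - 1) - 2 * (a \<bullet> b)) / (p * q)"
    using p q by (simp add: field_simps)
  finally show ?thesis by (simp add: ab p_def q_def)
qed

lemma stereographic_inner_None:
  "stereographic (Some a) \<bullet> stereographic None = 1 - 2 / (1 + (cmod a)\<^sup>2)"
proof -
  have "1 + (cmod a)\<^sup>2 > 0" by (simp add: add_pos_nonneg)
  then show ?thesis
    unfolding stereographic_def by (simp add: inner_prod_def field_simps)
qed

lemma arccos_less_if_near_1:
  assumes "\<epsilon> > 0"
  shows "\<exists>\<delta>>0. \<forall>x. 1 - \<delta> < x \<longrightarrow> x \<le> 1 \<longrightarrow> arccos x < \<epsilon>"
proof -
  have "continuous_on {-1..1} arccos"
    by (rule continuous_on_arccos')
  then have "\<exists>d>0. \<forall>x\<in>{-1..1}. dist x 1 < d \<longrightarrow> dist (arccos x) (arccos 1) < \<epsilon>"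
    using assms unfolding continuous_on_iff by (elim ballE[of _ _ 1]) auto
  then obtain d where d: "d > 0" "\<And>x. x \<in> {-1..1} \<Longrightarrow> dist x 1 < d \<Longrightarrow> dist (arccos x) (arccos 1) < \<epsilon>"
    by blast
  show ?thesis
  proof (intro exI[of _ "min d 1"] conjI allI impI)
    fix x :: real assume x: "1 - min d 1 < x" "x \<le> 1"
    then have "dist (arccos x) (arccos 1) < \<epsilon>"
      by (intro d(2)) (auto simp: dist_real_def)
    then show "arccos x < \<epsilon>" by (simp add: dist_real_def)
  qed (use d in auto)
qed

text \<open>The inner product of unit vectors is 1 minus half the squared chordal distance. The
  denominator of that fraction is at least 1 here, so Euclidean closeness implies spherical
  closeness uniformly in both points, however large they are.\<close>

lemma spherical_dist_Some_less:
  assumes "\<epsilon> > 0"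
  shows "\<exists>\<delta>>0. \<forall>a b. cmod (a - b) < \<delta> \<longrightarrow> spherical_dist (Some a) (Some b) < \<epsilon>"
proof -
  obtain \<delta> where \<delta>: "\<delta> > 0" "\<And>x. 1 - \<delta> < x \<Longrightarrow> x \<le> 1 \<Longrightarrow> arccos x < \<epsilon>"
    using arccos_less_if_near_1[OF assms] by blast
  show ?thesis
  proof (intro exI[of _ "sqrt (\<delta> / 2)"] conjI allI impI)
    fix a b assume ab: "cmod (a - b) < sqrt (\<delta> / 2)"
    have "(1::real) * 1 \<le> (1 + (cmod a)\<^sup>2) * (1 + (cmod b)\<^sup>2)"
      by (intro mult_mono) auto
    then have "2 * (cmod (a - b))\<^sup>2 / ((1 + (cmod a)\<^sup>2) * (1 + (cmod b)\<^sup>2)) \<le> 2 * (cmod (a - b))\<^sup>2 / 1"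
      by (intro divide_left_mono) auto
    also have "\<dots> < \<delta>"
      using ab power_strict_mono[OF ab norm_ge_zero, of 2] \<delta>(1) by simp
    finally show "spherical_dist (Some a) (Some b) < \<epsilon>"
      unfolding spherical_dist_def stereographic_inner_Some
      by (intro \<delta>(2)) auto
  qed (use \<delta> in auto)
qed

lemma spherical_dist_None_less:
  assumes "\<epsilon> > 0"
  shows "\<exists>R. \<forall>a. cmod a > R \<longrightarrow> spherical_dist (Some a) None < \<epsilon>"
proof -
  obtain \<delta> where \<delta>: "\<delta> > 0" "\<And>x. 1 - \<delta> < x \<Longrightarrow> x \<le> 1 \<Longrightarrow> arccos x < \<epsilon>"
    using arccos_less_if_near_1[OF assms] by blast
  show ?thesis
  proof (intro exI[of _ "sqrt (2 / \<delta>)"] allI impI)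
    fix a assume a: "cmod a > sqrt (2 / \<delta>)"
    have "2 / \<delta> < (cmod a)\<^sup>2"
      using power_strict_mono[OF a, of 2] \<delta>(1) by simp
    then have "2 < \<delta> * (1 + (cmod a)\<^sup>2)"
      using \<delta>(1) by (simp add: field_simps)
    then have "2 / (1 + (cmod a)\<^sup>2) < \<delta>"
      by (simp add: divide_less_eq add_pos_nonneg)
    then show "spherical_dist (Some a) None < \<epsilon>"
      unfolding spherical_dist_def stereographic_inner_None
      by (intro \<delta>(2)) (auto simp: add_nonneg_nonneg)
  qed
qed

text \<open>As arccos decreases, the distance to infinity is smallest at modulus \<open>R\<close>. A
  sequence that is bounded at a point therefore cannot converge to infinity there.\<close>

lemma spherical_dist_None_bounded_away:
  "\<exists>\<epsilon>>0. \<forall>a. cmod a \<le> R \<longrightarrow> \<epsilon> \<le> spherical_dist (Some a) None"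
proof -
  define y where "y = 1 - 2 / (1 + R\<^sup>2)"
  have R: "1 + R\<^sup>2 > 0" by (simp add: add_pos_nonneg)
  have y: "-1 \<le> y" "y < 1"
    using R unfolding y_def by (simp_all add: field_simps)
  show ?thesis
  proof (intro exI[of _ "arccos y"] conjI allI impI)
    show "arccos y > 0" using arccos_less_arccos[of y 1] y by simp
    fix a assume "cmod a \<le> R"
    then have "(cmod a)\<^sup>2 \<le> R\<^sup>2" by (intro power_mono) auto
    then have "2 / (1 + R\<^sup>2) \<le> 2 / (1 + (cmod a)\<^sup>2)"
      by (intro divide_left_mono) (auto simp: add_pos_nonneg)
    moreover have "2 / (1 + (cmod a)\<^sup>2) \<le> 2 / 1"
      by (intro divide_left_mono) (auto simp: add_pos_nonneg)
    ultimately show "arccos y \<le> spherical_dist (Some a) None"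
      unfolding spherical_dist_def stereographic_inner_None
      by (intro arccos_le_arccos) (use y in \<open>auto simp: y_def\<close>)
  qed
qed

text \<open>Agreement on a punctured neighbourhood is the right hypothesis because \<open>f\<close>
  and \<open>deriv f\<close> have arbitrary values at singularities. The values of f, f', f'/f and
  f''/f' are computed through this lemma from formulas continuous at the point.\<close>

lemma sphere_value_eq_Some:
  assumes "\<forall>\<^sub>F w in at z. f w = g w" "isCont g z"
  shows "sphere_value f z = Some (g z)"
proof -
  have lim: "f \<midarrow>z\<rightarrow> g z"
    using assms by (metis isContD tendsto_cong)
  then have "\<not> is_pole f z"
    using not_tendsto_and_filterlim_at_infinity[of "at z" f] by (auto simp: is_pole_def)
  with lim show ?thesis
    unfolding sphere_value_def by (simp add: remove_sings_eqI)
qed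

text \<open>Locally uniform convergence in the form delivered by Montel's theorem. A single
  \<open>F n\<close> may be singular somewhere in \<open>U\<close>, since a fixed compact set sees
  only the tail of the sequence.\<close>

definition compact_limit :: "complex set \<Rightarrow> (nat \<Rightarrow> complex \<Rightarrow> complex) \<Rightarrow> (complex \<Rightarrow> complex) \<Rightarrow> bool" where
  "compact_limit U F g \<longleftrightarrow> (\<forall>K. compact K \<longrightarrow> K \<subseteq> U \<longrightarrow> uniform_limit K F g sequentially)"

text \<open>\<open>val\<close> is asked only eventually on each compact set: every member of the
  sequence may have poles in \<open>U\<close>, as long as they drift out of each compact
  subset.\<close>

lemma spherical_limit_finite:
  assumes U: "open U" and lim: "compact_limit U F g"
    and val: "\<And>K. compact K \<Longrightarrow> K \<subseteq> U \<Longrightarrow> \<forall>\<^sub>F n in sequentially. \<forall>w\<in>K. sphere_value (f n) w = Some (F n w)"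
  shows "spherical_locally_uniform_limit U (\<lambda>n. sphere_value (f n)) (\<lambda>z. Some (g z))"
  unfolding spherical_locally_uniform_limit_def
proof
  fix z assume "z \<in> U"
  then obtain r where r: "r > 0" "cball z r \<subseteq> U" using U open_contains_cball by blast
  show "\<exists>r>0. \<forall>\<epsilon>>0. \<forall>\<^sub>F n in sequentially. \<forall>w\<in>ball z r \<inter> U.
          spherical_dist (sphere_value (f n) w) (Some (g w)) < \<epsilon>"
  proof (intro exI[of _ r] conjI allI impI)
    fix \<epsilon> :: real assume "\<epsilon> > 0"
    then obtain \<delta> where \<delta>: "\<delta> > 0" "\<And>a b. cmod (a - b) < \<delta> \<Longrightarrow> spherical_dist (Some a) (Some b) < \<epsilon>"
      using spherical_dist_Some_less by blast
    have "uniform_limit (cball z r) F g sequentially"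
      using lim r by (auto simp: compact_limit_def)
    then have "\<forall>\<^sub>F n in sequentially. \<forall>w\<in>cball z r. dist (F n w) (g w) < \<delta>"
      using \<delta>(1) by (rule uniform_limitD)
    with val[OF compact_cball r(2)]
    show "\<forall>\<^sub>F n in sequentially. \<forall>w\<in>ball z r \<inter> U. spherical_dist (sphere_value (f n) w) (Some (g w)) < \<epsilon>"
      by eventually_elim (auto intro!: \<delta>(2) simp: dist_norm)
  qed (use r in auto)
qed

lemma spherical_limit_infinite:
  assumes U: "open U"
    and lim: "\<And>K R. compact K \<Longrightarrow> K \<subseteq> U \<Longrightarrow> \<forall>\<^sub>F n in sequentially. \<forall>w\<in>K. cmod (F n w) > R"
    and val: "\<And>K. compact K \<Longrightarrow> K \<subseteq> U \<Longrightarrow> \<forall>\<^sub>F n in sequentially. \<forall>w\<in>K. sphere_value (f n) w = Some (F n w)"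
  shows "spherical_locally_uniform_limit U (\<lambda>n. sphere_value (f n)) (\<lambda>_. None)"
  unfolding spherical_locally_uniform_limit_def
proof
  fix z assume "z \<in> U"
  then obtain r where r: "r > 0" "cball z r \<subseteq> U" using U open_contains_cball by blast
  show "\<exists>r>0. \<forall>\<epsilon>>0. \<forall>\<^sub>F n in sequentially. \<forall>w\<in>ball z r \<inter> U.
          spherical_dist (sphere_value (f n) w) None < \<epsilon>"
  proof (intro exI[of _ r] conjI allI impI)
    fix \<epsilon> :: real assume "\<epsilon> > 0"
    then obtain R where R: "\<And>a. cmod a > R \<Longrightarrow> spherical_dist (Some a) None < \<epsilon>"
      using spherical_dist_None_less by blast
    from lim[OF compact_cball r(2), of R] val[OF compact_cball r(2)]
    show "\<forall>\<^sub>F n in sequentially. \<forall>w\<in>ball z r \<inter> U. spherical_dist (sphere_value (f n) w) None < \<epsilon>"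
      by eventually_elim (auto intro!: R)
  qed (use r in auto)
qed

text \<open>One common point decides, for there the values are eventually bounded and thus
  spherically away from infinity. \<open>U\<close> and \<open>T\<close> differ because each limit
  comes with its own exceptional set.\<close>

lemma spherical_limit_unique_finite:
  assumes lim: "compact_limit U F g"
    and val: "\<And>K. compact K \<Longrightarrow> K \<subseteq> U \<Longrightarrow> \<forall>\<^sub>F n in sequentially. \<forall>w\<in>K. sphere_value (f n) w = Some (F n w)"
    and inf: "spherical_locally_uniform_limit T (\<lambda>n. sphere_value (f n)) (\<lambda>_. None)"
    and z: "z \<in> U" "z \<in> T"
  shows False
proof -
  obtain \<epsilon> where \<epsilon>: "\<epsilon> > 0" "\<And>a. cmod a \<le> cmod (g z) + 1 \<Longrightarrow> \<epsilon> \<le> spherical_dist (Some a) None"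
    using spherical_dist_None_bounded_away by blast
  have "\<forall>\<^sub>F n in sequentially. spherical_dist (sphere_value (f n) z) None < \<epsilon>"
  proof -
    obtain r where "r > 0" "\<forall>\<^sub>F n in sequentially. \<forall>w\<in>ball z r \<inter> T. spherical_dist (sphere_value (f n) w) None < \<epsilon>"
      using inf z \<epsilon>(1) unfolding spherical_locally_uniform_limit_def by meson
    then show ?thesis using z(2) by (auto elim!: eventually_mono)
  qed
  moreover have "\<forall>\<^sub>F n in sequentially. sphere_value (f n) z = Some (F n z)"
    using val[of "{z}"] z by simp
  moreover have "\<forall>\<^sub>F n in sequentially. dist (F n z) (g z) < 1"
    using lim z(1) by (auto simp: compact_limit_def dest!: spec[of _ "{z}"] intro: tendstoD)
  ultimately have "\<forall>\<^sub>F n in sequentially. False"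
  proof eventually_elim
    case (elim n)
    have "cmod (F n z) \<le> cmod (g z) + 1"
      using elim(3) norm_triangle_ineq2[of "F n z" "g z"] by (simp add: dist_norm)
    with \<epsilon>(2)[of "F n z"] elim(1,2) show False by simp
  qed
  then show False by simp
qed

section \<open>Uniform convergence on compact sets\<close>

lemma compact_limitD: "compact_limit U F g \<Longrightarrow> compact K \<Longrightarrow> K \<subseteq> U \<Longrightarrow> uniform_limit K F g sequentially"
  by (simp add: compact_limit_def)

lemma compact_limit_tendsto: "compact_limit U F g \<Longrightarrow> z \<in> U \<Longrightarrow> (\<lambda>n. F n z) \<longlonglongrightarrow> g z"
  using compact_limitD[of U F g "{z}"] by simp

lemma compact_limit_subset: "compact_limit U F g \<Longrightarrow> T \<subseteq> U \<Longrightarrow> compact_limit T F g"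
  by (auto simp: compact_limit_def)

lemma compact_limit_subseq:
  assumes "compact_limit U F g" "strict_mono s"
  shows "compact_limit U (\<lambda>n. F (s n)) g"
  using assms unfolding compact_limit_def
  by (metis filterlim_compose filterlim_subseq)

lemma compact_limit_const: "a \<longlonglongrightarrow> b \<Longrightarrow> compact_limit U (\<lambda>n _. a n) (\<lambda>_. b)"
  unfolding compact_limit_def uniform_limit_iff tendsto_iff by (auto elim!: eventually_mono)

lemma bounded_image_compact: "continuous_on U g \<Longrightarrow> compact K \<Longrightarrow> K \<subseteq> U \<Longrightarrow> bounded (g ` K)"
  by (meson compact_continuous_image compact_imp_bounded continuous_on_subset)

lemma compact_limit_add:
  "compact_limit U F f \<Longrightarrow> compact_limit U G g \<Longrightarrow> compact_limit U (\<lambda>n z. F n z + G n z) (\<lambda>z. f z + g z)"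
  unfolding compact_limit_def by (auto intro!: uniform_limit_add)

lemma compact_limit_mult:
  assumes "compact_limit U F f" "compact_limit U G g" "continuous_on U f" "continuous_on U g"
  shows "compact_limit U (\<lambda>n z. F n z * G n z) (\<lambda>z. f z * g z)"
  using assms unfolding compact_limit_def by (auto intro!: uniform_lim_mult bounded_image_compact)

lemma compact_limit_power:
  assumes "compact_limit U F f" "continuous_on U f"
  shows "compact_limit U (\<lambda>n z. F n z ^ k) (\<lambda>z. f z ^ k)"
proof (induction k)
  case 0 show ?case using compact_limit_const[OF tendsto_const[of 1]] by simp
next
  case (Suc k)
  then show ?case using assms by (auto intro!: compact_limit_mult continuous_intros)
qed

lemma bounded_away_compact:
  fixes f :: "complex \<Rightarrow> complex"
  assumes "continuous_on U f" "\<And>z. z \<in> U \<Longrightarrow> f z \<noteq> 0" "compact K" "K \<subseteq> U"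
  shows "\<exists>b>0. \<forall>z\<in>K. b \<le> cmod (f z)"
proof (cases "K = {}")
  case False
  have "continuous_on K (\<lambda>z. cmod (f z))"
    using assms by (auto intro: continuous_on_norm continuous_on_subset)
  then obtain z0 where "z0 \<in> K" "\<And>z. z \<in> K \<Longrightarrow> cmod (f z0) \<le> cmod (f z)"
    using continuous_attains_inf[OF assms(3) False] by blast
  then show ?thesis using assms by (intro exI[of _ "cmod (f z0)"]) auto
qed (auto intro: exI[of _ 1])

lemma compact_limit_divide:
  assumes "compact_limit U F f" "compact_limit U G g" "continuous_on U f" "continuous_on U g"
    "\<And>z. z \<in> U \<Longrightarrow> g z \<noteq> 0"
  shows "compact_limit U (\<lambda>n z. F n z / G n z) (\<lambda>z. f z / g z)"
  unfolding compact_limit_def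
proof (intro allI impI)
  fix K assume K: "compact K" "K \<subseteq> U"
  obtain b where "b > 0" "\<And>z. z \<in> K \<Longrightarrow> b \<le> cmod (g z)"
    using bounded_away_compact[OF assms(4,5) K] by blast
  then show "uniform_limit K (\<lambda>n z. F n z / G n z) (\<lambda>z. f z / g z) sequentially"
    using assms K by (intro uniform_lim_divide[where b = b] bounded_image_compact[of U]) (auto simp: compact_limit_def)
qed

lemma compact_limit_eventually_bounded_away:
  assumes "compact_limit U F f" "continuous_on U f" "\<And>z. z \<in> U \<Longrightarrow> f z \<noteq> 0" "compact K" "K \<subseteq> U"
  shows "\<exists>b>0. \<forall>\<^sub>F n in sequentially. \<forall>z\<in>K. b \<le> cmod (F n z)"
proof -
  obtain b where b: "b > 0" "\<And>z. z \<in> K \<Longrightarrow> b \<le> cmod (f z)"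
    using bounded_away_compact[OF assms(2-5)] by blast
  have "\<forall>\<^sub>F n in sequentially. \<forall>z\<in>K. dist (F n z) (f z) < b / 2"
    using b by (intro uniform_limitD[OF compact_limitD[OF assms(1,4,5)]]) auto
  then have "\<forall>\<^sub>F n in sequentially. \<forall>z\<in>K. b / 2 \<le> cmod (F n z)"
  proof eventually_elim
    case (elim n)
    show ?case
    proof
      fix z assume "z \<in> K"
      then show "b / 2 \<le> cmod (F n z)"
        using elim b(2)[of z] norm_triangle_ineq2[of "f z" "F n z"] by (auto simp: dist_norm norm_minus_commute)
    qed
  qed
  then show ?thesis using b by (intro exI[of _ "b / 2"]) auto
qed

lemma compact_limit_eventually_nonzero:
  assumes "compact_limit U F f" "continuous_on U f" "\<And>z. z \<in> U \<Longrightarrow> f z \<noteq> 0" "compact K" "K \<subseteq> U"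
  shows "\<forall>\<^sub>F n in sequentially. \<forall>z\<in>K. F n z \<noteq> 0"
proof -
  obtain b where "b > 0" "\<forall>\<^sub>F n in sequentially. \<forall>z\<in>K. b \<le> cmod (F n z)"
    using compact_limit_eventually_bounded_away[OF assms] by blast
  then show ?thesis by (auto elim!: eventually_mono)
qed

lemma compact_limitI_local:
  assumes "\<And>z. z \<in> U \<Longrightarrow> \<exists>r>0. uniform_limit (ball z r) F g sequentially"
  shows "compact_limit U F g"
  unfolding compact_limit_def
proof (intro allI impI)
  fix K assume K: "compact K" "K \<subseteq> U"
  obtain r where r: "\<And>z. z \<in> U \<Longrightarrow> r z > 0 \<and> uniform_limit (ball z (r z)) F g sequentially"
    using assms by metis
  have cover: "K \<subseteq> (\<Union>z\<in>K. ball z (r z))" using r K(2) by (meson UN_I centre_in_ball subset_eq)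
  obtain T where T: "T \<subseteq> K" "finite T" "K \<subseteq> (\<Union>z\<in>T. ball z (r z))"
    using compactE_image[OF K(1) _ cover] by blast
  show "uniform_limit K F g sequentially"
  proof (rule uniform_limitI)
    fix e :: real assume e: "e > 0"
    have "\<forall>\<^sub>F n in sequentially. \<forall>z\<in>T. \<forall>x\<in>ball z (r z). dist (F n x) (g x) < e"
      using T K r e by (intro eventually_ball_finite) (auto intro!: uniform_limitD)
    then show "\<forall>\<^sub>F n in sequentially. \<forall>x\<in>K. dist (F n x) (g x) < e"
      by eventually_elim (use T(3) in blast)
  qed
qed

text \<open>Cauchy's estimate on circles of radius r about the points of a ball of radius r; the
  ball of doubled radius contains all these circles.\<close>

lemma compact_limit_deriv:
  assumes U: "open U" and F: "\<And>n. F n holomorphic_on U" and g: "g holomorphic_on U"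
    and lim: "compact_limit U F g"
  shows "compact_limit U (\<lambda>n. deriv (F n)) (deriv g)"
proof (rule compact_limitI_local)
  fix z assume "z \<in> U"
  then obtain r0 where r0: "r0 > 0" "cball z r0 \<subseteq> U" using U open_contains_cball by blast
  obtain r where r: "r > 0" "cball z (2 * r) \<subseteq> U" by (rule that[of "r0 / 2"]) (use r0 in auto)
  show "\<exists>r>0. uniform_limit (ball z r) (\<lambda>n. deriv (F n)) (deriv g) sequentially"
  proof (intro exI[of _ r] conjI uniform_limitI r)
    fix e :: real assume e: "e > 0"
    have "uniform_limit (cball z (2 * r)) F g sequentially"
      using lim r(2) by (rule compact_limitD[OF _ compact_cball])
    \<comment> \<open>Dividing by the radius \<open>r\<close> in Cauchy's estimate leaves e / 2, so
      the final bound is strict.\<close>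
    then have "\<forall>\<^sub>F n in sequentially. \<forall>x\<in>cball z (2 * r). dist (F n x) (g x) < e * r / 2"
      by (rule uniform_limitD) (use e r in auto)
    then show "\<forall>\<^sub>F n in sequentially. \<forall>x\<in>ball z r. dist (deriv (F n) x) (deriv g x) < e"
    proof eventually_elim
      case (elim n)
      show ?case
      proof
        fix x assume x: "x \<in> ball z r"
        have sub: "cball x r \<subseteq> cball z (2 * r)"
        proof
          fix y assume "y \<in> cball x r"
          then show "y \<in> cball z (2 * r)" using x dist_triangle[of z y x] by simp
        qed
        have subU: "cball x r \<subseteq> U" using sub r(2) by blast
        have xU: "x \<in> U" using subU r(1) by auto
        have hol: "(\<lambda>y. F n y - g y) holomorphic_on U" by (intro holomorphic_intros F g)
        have bd: "cmod (F n y - g y) \<le> e * r / 2" if "cmod (x - y) = r" for y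
        proof -
          have "y \<in> cball z (2 * r)" using sub that by (auto simp: dist_norm)
          then show ?thesis using elim by (auto simp: dist_norm intro: less_imp_le)
        qed
        have "cmod ((deriv ^^ 1) (\<lambda>y. F n y - g y) x) \<le> fact 1 * (e * r / 2) / r ^ 1"
        proof (rule Cauchy_inequality)
          show "(\<lambda>y. F n y - g y) holomorphic_on ball x r"
            using hol by (rule holomorphic_on_subset) (use subU in auto)
          show "continuous_on (cball x r) (\<lambda>y. F n y - g y)"
            using holomorphic_on_imp_continuous_on[OF hol] by (rule continuous_on_subset) (use subU in auto)
        qed (use r bd in auto)
        moreover have "deriv (\<lambda>y. F n y - g y) x = deriv (F n) x - deriv g x"
          using F g U xU by (intro deriv_diff) (auto intro: holomorphic_on_imp_differentiable_at)
        ultimately have "cmod (deriv (F n) x - deriv g x) \<le> e / 2" using r by simp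
        then show "dist (deriv (F n) x) (deriv g x) < e" using e by (simp add: dist_norm)
      qed
    qed
  qed
qed

text \<open>On a disk the mean value inequality for \<open>F m - F n\<close> spreads convergence
  from one point to all points, and connectedness of \<open>U\<close> spreads it from disk to disk;
  simple connectedness does not enter. \<open>der\<close> holds only eventually because
  \<open>F n\<close> may have poles in \<open>U\<close>.\<close>

lemma compact_limit_primitives:
  assumes U: "open U" "connected U" and a: "a \<in> U" "(\<lambda>n. F n a) \<longlonglongrightarrow> c"
    and lim: "compact_limit U f g" and g: "continuous_on U g"
    and der: "\<And>K. compact K \<Longrightarrow> K \<subseteq> U \<Longrightarrow>
      \<forall>\<^sub>F n in sequentially. \<forall>z\<in>K. (F n has_field_derivative f n z) (at z)"
  shows "\<exists>G. compact_limit U F G \<and> (\<forall>z\<in>U. (G has_field_derivative g z) (at z))"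
proof -
  have loc: "uniformly_convergent_on (cball z r) F"
    if r: "cball z r \<subseteq> U" and y: "y \<in> cball z r" "convergent (\<lambda>n. F n y)" for z y r
  proof (intro Cauchy_uniformly_convergent)
    have "dist z y \<le> r" using y(1) by simp
    then have r0: "r \<ge> 0" by (rule order_trans[OF zero_le_dist])
    show "uniformly_Cauchy_on (cball z r) F"
      unfolding uniformly_Cauchy_on_def
    proof (intro allI impI)
      fix e :: real assume e: "e > 0"
      \<comment> \<open>Two points of the disk are at most 2 r apart, so the mean value inequality
        contributes less than e / 2; the summand 1 covers r = 0.\<close>
      define d where "d = e / (2 * (2 * r + 1))"
      have d: "d > 0" "d * (2 * r) < e / 2" using e r0 unfolding d_def by (auto simp: field_simps)
      have "uniformly_convergent_on (cball z r) f"
        using compact_limitD[OF lim compact_cball r] by (auto simp: uniformly_convergent_on_def)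
      then have "uniformly_Cauchy_on (cball z r) f" by (rule uniformly_convergent_Cauchy)
      then obtain M1 where M1: "\<And>x m n. x \<in> cball z r \<Longrightarrow> m \<ge> M1 \<Longrightarrow> n \<ge> M1 \<Longrightarrow> dist (f m x) (f n x) < d"
        using d(1) unfolding uniformly_Cauchy_on_def by meson
      obtain M2 where M2: "\<And>m n. m \<ge> M2 \<Longrightarrow> n \<ge> M2 \<Longrightarrow> dist (F m y) (F n y) < e / 2"
        using convergent_Cauchy[OF y(2)] e unfolding Cauchy_def by (meson half_gt_zero)
      obtain M3 where M3: "\<And>n x. n \<ge> M3 \<Longrightarrow> x \<in> cball z r \<Longrightarrow> (F n has_field_derivative f n x) (at x)"
        using der[OF compact_cball r, unfolded eventually_sequentially] by (elim exE) (rule that, blast)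
      show "\<exists>M. \<forall>x\<in>cball z r. \<forall>m\<ge>M. \<forall>n\<ge>M. dist (F m x) (F n x) < e"
      proof (intro exI[of _ "max M1 (max M2 M3)"] ballI allI impI)
        fix x m n assume x: "x \<in> cball z r" and mn: "max M1 (max M2 M3) \<le> m" "max M1 (max M2 M3) \<le> n"
        have "norm ((F m x - F n x) - (F m y - F n y)) \<le> d * norm (x - y)"
        proof (rule field_differentiable_bound[of "cball z r" "\<lambda>x. F m x - F n x" "\<lambda>x. f m x - f n x"])
          fix u assume u: "u \<in> cball z r"
          show "((\<lambda>x. F m x - F n x) has_field_derivative f m u - f n u) (at u within cball z r)"
            by (rule has_field_derivative_at_within) (use M3 u mn in \<open>auto intro!: DERIV_diff\<close>)
          show "norm (f m u - f n u) \<le> d"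
            using M1[OF u, of m n] mn by (simp add: dist_norm)
        qed (use x y in auto)
        also have "\<dots> \<le> d * (2 * r)"
          using x y d(1) dist_triangle3[of x y z] by (intro mult_left_mono) (auto simp: dist_norm)
        finally have "norm ((F m x - F n x) - (F m y - F n y)) < e / 2" using d(2) by simp
        moreover have "norm (F m y - F n y) < e / 2" using M2[of m n] mn by (simp add: dist_norm)
        ultimately show "dist (F m x) (F n x) < e"
          using norm_triangle_ineq[of "(F m x - F n x) - (F m y - F n y)" "F m y - F n y"]
          by (simp add: dist_norm)
      qed
    qed
  qed
  have conv_point: "convergent (\<lambda>n. F n x)" if S: "uniformly_convergent_on S F" "x \<in> S" for S x
  proof -
    obtain l where "uniform_limit S F l sequentially"
      using S(1) by (auto simp: uniformly_convergent_on_def)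
    then have "(\<lambda>n. F n x) \<longlonglongrightarrow> l x" using S(2) by (rule tendsto_uniform_limitI)
    then show ?thesis by (rule convergentI)
  qed
  define A where "A = {z \<in> U. convergent (\<lambda>n. F n z)}"
  \<comment> \<open>A small disk in \<open>U\<close> lies in \<open>A\<close> as soon as one of its
    points does, so both \<open>A\<close> and \<open>U - A\<close> are open.\<close>
  have ball_in: "\<exists>r>0. ball z r \<subseteq> A \<or> ball z r \<subseteq> U - A" if z: "z \<in> U" for z
  proof -
    obtain r where r: "r > 0" "cball z r \<subseteq> U" using U z open_contains_cball by blast
    have "ball z r \<subseteq> A \<or> ball z r \<subseteq> U - A"
    proof (rule ccontr)
      assume "\<not> ?thesis"
      then obtain x y where xy: "x \<in> ball z r" "x \<notin> A" "y \<in> ball z r" "y \<in> A"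
        using r by (meson DiffI ball_subset_cball subset_eq)
      then have "uniformly_convergent_on (cball z r) F" using loc[OF r(2), of y] by (auto simp: A_def)
      moreover have x: "x \<in> cball z r" using xy by simp
      ultimately have "convergent (\<lambda>n. F n x)" by (rule conv_point)
      then show False using xy(2) subsetD[OF r(2) x] by (simp add: A_def)
    qed
    then show ?thesis using r by blast
  qed
  have "open A"
    unfolding open_contains_ball
  proof
    fix z assume z: "z \<in> A"
    then obtain r where "r > 0" "ball z r \<subseteq> A \<or> ball z r \<subseteq> U - A" using ball_in by (auto simp: A_def)
    then show "\<exists>e>0. ball z e \<subseteq> A" using z centre_in_ball by blast
  qed
  moreover have "open (U - A)"
    unfolding open_contains_ball
  proof
    fix z assume z: "z \<in> U - A"
    then obtain r where "r > 0" "ball z r \<subseteq> A \<or> ball z r \<subseteq> U - A" using ball_in by auto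
    then show "\<exists>e>0. ball z e \<subseteq> U - A" using z centre_in_ball by blast
  qed
  moreover have "a \<in> A" using a by (auto simp: A_def convergent_def)
  ultimately have AU: "A = U"
    using connectedD[OF U(2), of A "U - A"] a(1) by (auto simp: A_def)
  define G where "G = (\<lambda>z. lim (\<lambda>n. F n z))"
  have unif: "uniform_limit (cball z r) F G sequentially" if r: "cball z r \<subseteq> U" "r > 0" for z r
  proof -
    have "z \<in> A" using AU subsetD[OF r(1), of z] r(2) by auto
    then have "convergent (\<lambda>n. F n z)" by (simp add: A_def)
    then have "uniformly_convergent_on (cball z r) F" using loc[OF r(1), of z] r by auto
    then show ?thesis unfolding G_def uniformly_convergent_uniform_limit_iff .
  qed
  have "compact_limit U F G"
  proof (rule compact_limitI_local)
    fix z assume "z \<in> U"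
    then obtain r where r: "r > 0" "cball z r \<subseteq> U" using U open_contains_cball by blast
    have "uniform_limit (ball z r) F G sequentially"
      using unif[OF r(2,1)] ball_subset_cball by (rule uniform_limit_on_subset)
    then show "\<exists>r>0. uniform_limit (ball z r) F G sequentially" using r(1) by blast
  qed
  moreover have "(G has_field_derivative g z) (at z)" if z: "z \<in> U" for z
  proof -
    obtain r where r: "r > 0" "cball z r \<subseteq> U" using U z open_contains_cball by blast
    have "\<forall>\<^sub>F n in sequentially. continuous_on (cball z r) (F n) \<and>
            (\<forall>w\<in>ball z r. (F n has_field_derivative f n w) (at w))"
      using der[OF compact_cball r(2)]
      by eventually_elim (auto intro!: continuous_at_imp_continuous_on DERIV_isCont)
    \<comment> \<open>The limit theorem provides some derivative that is the pointwise limit of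
      \<open>f n\<close>; uniqueness of limits identifies it with \<open>g\<close>.\<close>
    then obtain g' where g': "\<And>w. w \<in> ball z r \<Longrightarrow> (G has_field_derivative g' w) (at w) \<and> (\<lambda>n. f n w) \<longlonglongrightarrow> g' w"
      using has_complex_derivative_uniform_limit[OF _ unif[OF r(2,1)] trivial_limit_sequentially r(1)] by blast
    have "g' z = g z"
      using g'[of z] r compact_limit_tendsto[OF lim z] by (auto intro: LIMSEQ_unique)
    then show ?thesis using g'[of z] r by auto
  qed
  ultimately show ?thesis by blast
qed

section \<open>Exceptional sets and isolated singularities of primitives\<close>

lemma no_accumulation_of_cosparse:
  assumes "open D" "\<forall>\<^sub>\<approx>z\<in>D. P z"
  shows "no_accumulation_in {z \<in> D. \<not> P z} D" and "open {z \<in> D. P z}"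
    and "connected D \<Longrightarrow> connected {z \<in> D. P z}"
proof -
  have sp: "{z. \<not> P z} sparse_in D" using assms(2) by (simp add: eventually_cosparse)
  have "{z \<in> D. \<not> P z} sparse_in D" using sp by (rule sparse_in_subset2) auto
  then show "no_accumulation_in {z \<in> D. \<not> P z} D"
    using sparse_in_open[OF assms(1)] by (auto simp: no_accumulation_in_def)
  have eq: "{z \<in> D. P z} = D - {z. \<not> P z}" by auto
  show "open {z \<in> D. P z}" unfolding eq by (rule open_diff_sparse_pts[OF assms(1) sp])
  show "connected {z \<in> D. P z}" if "connected D"
    unfolding eq using sparse_imp_connected[OF _ that assms(1) sp] by simp
qed

text \<open>Let \<open>m\<close> be the pole order of \<open>g\<close> (0 if there is no pole).
  Following a radius from \<open>z\<close> out to a fixed circle, the bound C / |z - e|^m for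
  \<open>g\<close> yields one of the same order for \<open>G\<close>, so (z - e)^(m+1) G tends to 0
  and \<open>e\<close> is at worst a pole. A logarithm cannot occur because \<open>der\<close> gives
  a single-valued primitive around \<open>e\<close>.\<close>

lemma primitive_meromorphic_at:
  assumes r: "r > 0" and der: "\<And>z. z \<in> ball e r - {e} \<Longrightarrow> (G has_field_derivative g z) (at z)"
    and g: "g meromorphic_on {e}" and nz: "\<exists>\<^sub>F z in at e. g z \<noteq> 0"
  shows "G meromorphic_on {e}"
proof -
  define n where "n = zorder g e"
  define p where "p = zor_poly g e"
  obtain r1 where r1: "r1 > 0" and p: "p holomorphic_on cball e r1"
    and gz: "\<And>z. z \<in> cball e r1 - {e} \<Longrightarrow> g z = p z * (z - e) powi n"
    using zorder_exist[OF meromorphic_on_isolated_singularity[OF g] meromorphic_on_not_essential[OF g] nz]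
    unfolding n_def p_def by blast
  \<comment> \<open>The bound 1 makes powers of |z - e| decrease in the exponent and keeps radial
    segments shorter than 1; r / 2 keeps the circle where \<open>G\<close> is
    differentiable.\<close>
  define \<rho> where "\<rho> = min (r / 2) (min r1 1)"
  have rho: "\<rho> > 0" "\<rho> < r" "\<rho> \<le> r1" "\<rho> \<le> 1" using r r1 by (auto simp: \<rho>_def)
  define m where "m = nat (- n)"
  have "continuous_on (cball e \<rho>) p"
    using holomorphic_on_imp_continuous_on[OF p] by (rule continuous_on_subset) (use rho in auto)
  then have "bounded (p ` cball e \<rho>)"
    by (intro compact_imp_bounded compact_continuous_image compact_cball)
  then obtain C where C: "C > 0" "\<And>z. z \<in> cball e \<rho> \<Longrightarrow> cmod (p z) \<le> C"
    unfolding bounded_pos by blast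
  have g_le: "cmod (g z) \<le> C / cmod (z - e) ^ m" if z: "z \<in> cball e \<rho> - {e}" for z
  proof -
    have t: "0 < cmod (z - e)" "cmod (z - e) \<le> 1" using z rho by (auto simp: dist_norm norm_minus_commute)
    have "cmod (g z) = cmod (p z) * cmod (z - e) powi n"
      using gz[of z] z rho by (simp add: norm_mult norm_power_int)
    also have "\<dots> \<le> C * cmod (z - e) powi (- int m)"
      using C z t by (intro mult_mono power_int_decreasing) (auto simp: m_def)
    finally show ?thesis by (simp add: power_int_minus divide_inverse)
  qed
  have contG: "continuous_on (sphere e \<rho>) G"
    using rho by (intro continuous_at_imp_continuous_on ballI DERIV_isCont[OF der]) auto
  then have "bounded (G ` sphere e \<rho>)"
    by (intro compact_imp_bounded compact_continuous_image compact_sphere)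
  then obtain C2 where C2: "C2 > 0" "\<And>z. z \<in> sphere e \<rho> \<Longrightarrow> cmod (G z) \<le> C2"
    unfolding bounded_pos by blast
  have G_le: "cmod (G z) \<le> C2 + C / cmod (z - e) ^ m" if z: "z \<in> ball e \<rho> - {e}" for z
  proof -
    define t where "t = cmod (z - e)"
    have t: "0 < t" "t < \<rho>" using z by (auto simp: t_def dist_norm norm_minus_commute)
    \<comment> \<open>The radial projection of \<open>z\<close> to the circle of radius \<rho>.
      Along the segment from \<open>z\<close> to \<open>y\<close> the distance to \<open>e\<close>
      is at least \<open>t\<close>, so the bound for \<open>g\<close> is largest at
      \<open>z\<close>.\<close>
    define y where "y = e + of_real (\<rho> / t) * (z - e)"
    have y: "y \<in> sphere e \<rho>"
      using t by (auto simp: y_def dist_norm norm_mult norm_divide t_def[symmetric])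
    have seg: "t \<le> cmod (x - e) \<and> cmod (x - e) \<le> \<rho>" if x: "x \<in> closed_segment z y" for x
    proof -
      obtain u where u: "0 \<le> u" "u \<le> 1" "x = (1 - u) *\<^sub>R z + u *\<^sub>R y"
        using x by (auto simp: in_segment)
      have "x - e = of_real (1 - u + u * \<rho> / t) * (z - e)"
        unfolding u(3) y_def by (simp add: scaleR_conv_of_real algebra_simps)
      then have "cmod (x - e) = \<bar>1 - u + u * \<rho> / t\<bar> * t"
        by (simp only: norm_mult norm_of_real t_def)
      also have "\<dots> = (1 - u + u * \<rho> / t) * t"
        using u t by (subst abs_of_nonneg) (auto intro!: add_nonneg_nonneg)
      also have "\<dots> = t + u * (\<rho> - t)" using t by (simp add: field_simps)
      finally have eq: "cmod (x - e) = t + u * (\<rho> - t)" .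
      have "0 \<le> u * (\<rho> - t)" "u * (\<rho> - t) \<le> 1 * (\<rho> - t)"
        using u t by (auto intro!: mult_right_mono mult_nonneg_nonneg)
      then show ?thesis using eq by simp
    qed
    have "cmod (G z - G y) \<le> C / t ^ m * cmod (z - y)"
    proof (rule field_differentiable_bound[of "closed_segment z y"])
      fix x assume x: "x \<in> closed_segment z y"
      have x': "x \<in> cball e \<rho> - {e}"
        using seg[OF x] t by (auto simp: dist_norm norm_minus_commute)
      show "(G has_field_derivative g x) (at x within closed_segment z y)"
        by (rule has_field_derivative_at_within, rule der) (use x' rho in auto)
      have "cmod (g x) \<le> C / cmod (x - e) ^ m" by (rule g_le[OF x'])
      also have "\<dots> \<le> C / t ^ m"
        using seg[OF x] t C(1) by (intro divide_left_mono power_mono mult_pos_pos zero_less_power) auto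
      finally show "cmod (g x) \<le> C / t ^ m" .
    qed auto
    also have "cmod (z - y) \<le> 1"
    proof -
      have "z - y = of_real (1 - \<rho> / t) * (z - e)" unfolding y_def by (simp add: algebra_simps)
      then have "cmod (z - y) = \<bar>1 - \<rho> / t\<bar> * t" by (simp only: norm_mult norm_of_real t_def)
      also have "\<dots> = \<rho> - t" using t by (simp add: abs_if field_simps)
      finally show ?thesis using t rho by simp
    qed
    then have "C / t ^ m * cmod (z - y) \<le> C / t ^ m * 1"
      using C(1) t by (intro mult_left_mono) auto
    finally show ?thesis
      using C2(2)[OF y] norm_triangle_ineq2[of "G z" "G y"] by (simp add: t_def)
  qed
  \<comment> \<open>One factor more than the order of growth forces the limit 0, and a limit is all
    that is required of an isolated singularity to be inessential.\<close>
  define H where "H = (\<lambda>z. G z * (z - e) ^ (m + 1))"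
  have H_le: "cmod (H z) \<le> (C2 + C) * cmod (z - e)" if z: "z \<in> ball e \<rho> - {e}" for z
  proof -
    define t where "t = cmod (z - e)"
    have t: "0 < t" "t \<le> 1" using z rho by (auto simp: t_def dist_norm norm_minus_commute)
    have "cmod (H z) = cmod (G z) * t ^ (m + 1)" by (simp add: H_def norm_mult norm_power t_def)
    also have "\<dots> \<le> (C2 + C / t ^ m) * t ^ (m + 1)"
      using G_le[OF z] t by (intro mult_right_mono) (auto simp: t_def)
    also have "\<dots> = C2 * t ^ m * t + C * t" using t by (simp add: field_simps)
    also have "\<dots> \<le> C2 * 1 * t + C * t"
      using C2(1) t by (intro add_right_mono mult_right_mono mult_left_mono power_le_one) auto
    finally show ?thesis by (simp add: t_def algebra_simps)
  qed
  have ev: "\<forall>\<^sub>F z in at e. z \<in> ball e \<rho> - {e}"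
    using eventually_at_in_open[of "ball e \<rho>" e] rho by simp
  have "((\<lambda>z. (C2 + C) * cmod (z - e)) \<longlongrightarrow> (C2 + C) * cmod (e - e)) (at e)"
    by (intro tendsto_intros)
  then have "((\<lambda>z. (C2 + C) * cmod (z - e)) \<longlongrightarrow> 0) (at e)" by simp
  then have H0: "H \<midarrow>e\<rightarrow> 0"
    by (rule Lim_null_comparison[rotated]) (use ev H_le in \<open>auto elim!: eventually_mono\<close>)
  have "H holomorphic_on ball e \<rho> - {e}"
  proof -
    have "G holomorphic_on ball e \<rho> - {e}"
      unfolding holomorphic_on_def field_differentiable_def
    proof
      fix z assume "z \<in> ball e \<rho> - {e}"
      then have "z \<in> ball e r - {e}" using rho by auto
      then show "\<exists>f'. (G has_field_derivative f') (at z within ball e \<rho> - {e})"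
        using der has_field_derivative_at_within by blast
    qed
    then show ?thesis unfolding H_def by (intro holomorphic_intros)
  qed
  then have "isolated_singularity_at H e"
    using rho(1) by (intro isolated_singularity_at_holomorphic[of _ "ball e \<rho>"]) auto
  then have H: "H meromorphic_on {e}"
    using H0 by (auto simp: meromorphic_at_iff not_essential_def)
  have "(\<lambda>z. H z / (z - e) ^ (m + 1)) meromorphic_on {e}"
    by (intro meromorphic_intros H)
  moreover have "(\<lambda>z. H z / (z - e) ^ (m + 1)) meromorphic_on {e} \<longleftrightarrow> G meromorphic_on {e}"
  proof (rule meromorphic_on_cong)
    show "\<forall>\<^sub>F w in at z. H w / (w - e) ^ (m + 1) = G w" if "z \<in> {e}" for z
    proof -
      have "\<forall>\<^sub>F w in at e. H w / (w - e) ^ (m + 1) = G w"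
        using ev by eventually_elim (simp add: H_def)
      then show ?thesis using that by simp
    qed
  qed auto
  ultimately show ?thesis by blast
qed

section \<open>The differential equation for a root of the derivative\<close>

text \<open>The shift by 2 skips the filler values, so that \<open>i\<close> counts the recursion
  steps applied to f''/f' and S_k is the case i = k - 1.\<close>

lemma S_aux_rec:
  "S_aux n (Suc i + 2) f = (\<lambda>z. deriv (S_aux n (i + 2) f) z
     - 1 / of_nat n * (deriv (deriv f) z / deriv f z) * S_aux n (i + 2) f z)"
  by simp

text \<open>The new numerator is z \<phi>' - (i+1) \<phi> - \<psi> \<phi> / k. At 0 its first term
  drops out, so each step multiplies the leading coefficient by -(i+1) - \<psi>(0)/k.\<close>

lemma S_aux_pole_form:
  fixes r :: real
  assumes psi: "\<psi> holomorphic_on ball 0 r"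
    and q: "\<And>z. z \<in> ball 0 r - {0} \<Longrightarrow> deriv (deriv f) z / deriv f z = \<psi> z / z"
  shows "\<exists>\<phi>. \<phi> holomorphic_on ball 0 r \<and> \<phi> 0 = \<psi> 0 * (\<Prod>j=1..i. - of_nat j - \<psi> 0 / of_nat k) \<and>
           (\<forall>z\<in>ball 0 r - {0}. S_aux k (i + 2) f z = \<phi> z / z ^ (i + 1))"
proof (induction i)
  case 0
  show ?case using psi q by (intro exI[of _ \<psi>]) auto
next
  case (Suc i)
  then obtain \<phi> where hol: "\<phi> holomorphic_on ball 0 r"
    and val: "\<phi> 0 = \<psi> 0 * (\<Prod>j=1..i. - of_nat j - \<psi> 0 / of_nat k)"
    and eq: "\<And>z. z \<in> ball 0 r - {0} \<Longrightarrow> S_aux k (i + 2) f z = \<phi> z / z ^ (i + 1)" by blast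
  define \<phi>' where "\<phi>' = (\<lambda>z. z * deriv \<phi> z - of_nat (i + 1) * \<phi> z - \<psi> z * \<phi> z / of_nat k)"
  show ?case
  proof (intro exI[of _ \<phi>'] conjI ballI)
    show "\<phi>' holomorphic_on ball 0 r"
      unfolding \<phi>'_def by (intro holomorphic_intros hol psi open_ball)
         (auto simp: divide_inverse intro!: holomorphic_intros hol psi)
    show "\<phi>' 0 = \<psi> 0 * (\<Prod>j=1..Suc i. - of_nat j - \<psi> 0 / of_nat k)"
      unfolding \<phi>'_def val by (simp add: algebra_simps)
    fix z :: complex assume z: "z \<in> ball 0 r - {0}"
    have op: "open (ball (0::complex) r - {0})" by (intro open_delete open_ball)
    have d: "(\<phi> has_field_derivative deriv \<phi> z) (at z)"
      using hol z by (intro holomorphic_derivI[of _ "ball 0 r"]) auto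
    have nz: "z \<noteq> 0" using z by simp
    have "((\<lambda>z. \<phi> z / z ^ (i + 1)) has_field_derivative
        (deriv \<phi> z * z ^ (i + 1) - \<phi> z * (of_nat (i + 1) * z ^ i)) / (z ^ (i + 1) * z ^ (i + 1))) (at z)"
      using DERIV_divide[OF d DERIV_power[OF DERIV_ident, of "i + 1" z]] nz by (simp add: mult.commute)
    then have "(S_aux k (i + 2) f has_field_derivative
        (deriv \<phi> z * z ^ (i + 1) - \<phi> z * (of_nat (i + 1) * z ^ i)) / (z ^ (i + 1) * z ^ (i + 1))) (at z)"
      by (rule has_field_derivative_transform_within_open[OF _ op z]) (use eq in auto)
    then have D: "deriv (S_aux k (i + 2) f) z =
        (deriv \<phi> z * z ^ (i + 1) - \<phi> z * (of_nat (i + 1) * z ^ i)) / (z ^ (i + 1) * z ^ (i + 1))"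
      by (rule DERIV_imp_deriv)
    show "S_aux k (Suc i + 2) f z = \<phi>' z / z ^ (Suc i + 1)"
      unfolding S_aux_rec D q[OF z] eq[OF z] \<phi>'_def using nz
      by (simp add: field_simps)
  qed
qed

text \<open>This is the linearisation. With f''/f' = - k w'/w, one recursion step sends T to T' +
  (w'/w) T = (w T)' / w, so w T is merely differentiated, starting from - k w'.\<close>

lemma S_aux_root_form:
  assumes w: "w holomorphic_on U" "open U" "\<And>z. z \<in> U \<Longrightarrow> w z \<noteq> 0" and k: "k \<ge> 1"
    and q: "\<And>z. z \<in> U \<Longrightarrow> deriv (deriv f) z / deriv f z = - of_nat k * deriv w z / w z"
    and z: "z \<in> U"
  shows "S_aux k (i + 2) f z = - of_nat k * (deriv ^^ (i + 1)) w z / w z"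
  using z
proof (induction i arbitrary: z)
  case 0
  then show ?case using q by simp
next
  case (Suc i)
  let ?d = "\<lambda>i. (deriv ^^ i) w"
  have d: "(?d i has_field_derivative ?d (Suc i) z) (at z)" for i
    using holomorphic_derivI[OF holomorphic_higher_deriv[OF w(1,2), of i] w(2) Suc.prems] by simp
  have nz: "w z \<noteq> 0" using w Suc.prems by simp
  have "((\<lambda>z. - of_nat k * ?d (i + 1) z / w z) has_field_derivative
      (- of_nat k * ?d (i + 2) z * w z - - of_nat k * ?d (i + 1) z * ?d 1 z) / (w z * w z)) (at z)"
    using nz d[of 0] d[of "i + 1"] by (auto intro!: derivative_eq_intros simp: field_simps)
  then have "(S_aux k (i + 2) f has_field_derivative
      (- of_nat k * ?d (i + 2) z * w z - - of_nat k * ?d (i + 1) z * ?d 1 z) / (w z * w z)) (at z)"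
    by (rule has_field_derivative_transform_within_open[OF _ w(2) Suc.prems]) (use Suc.IH in auto)
  then have D: "deriv (S_aux k (i + 2) f) z =
      (- of_nat k * ?d (i + 2) z * w z - - of_nat k * ?d (i + 1) z * ?d 1 z) / (w z * w z)"
    by (rule DERIV_imp_deriv)
  show ?case
    unfolding S_aux_rec D q[OF Suc.prems] Suc.IH[OF Suc.prems] using nz k
    by (simp add: field_simps)
qed

text \<open>
  The condition at the origin: if \<open>m\<close> is the order of \<open>f'\<close> there, then \<open>S\<^sub>k(f)\<close> has a pole of order
  \<open>k\<close> unless \<open>m \<Prod>\<^sub>j (- j - m/k) = 0\<close>, i.e. unless \<open>m\<close> is a nonpositive multiple of \<open>k\<close>.
\<close>

lemma derivative_eq_inverse_power_near_0:
  assumes mero: "f meromorphic_on {0}" and nz: "\<exists>\<^sub>F z in at 0. deriv f z \<noteq> 0"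
    and pole: "\<not> is_pole (S_aux k (k + 1) f) 0" and k: "k \<ge> 1"
  shows "\<exists>r>0. \<exists>w. w holomorphic_on ball 0 r \<and>
           (\<forall>z\<in>ball 0 r - {0}. w z \<noteq> 0 \<and> deriv f z = 1 / w z ^ k)"
proof -
  define m where "m = zorder (deriv f) 0"
  define g where "g = zor_poly (deriv f) 0"
  have dm: "deriv f meromorphic_on {0}" using mero by (rule meromorphic_on_deriv)
  obtain r where g0: "g 0 \<noteq> 0" and r: "r > 0" and gh: "g holomorphic_on cball 0 r"
    and gz: "\<And>z. z \<in> cball 0 r - {0} \<Longrightarrow> deriv f z = g z * z powi m \<and> g z \<noteq> 0"
    using zorder_exist[OF meromorphic_on_isolated_singularity[OF dm] meromorphic_on_not_essential[OF dm] nz]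
    unfolding m_def g_def by auto
  have gh: "g holomorphic_on ball 0 r" using gh by (rule holomorphic_on_subset) auto
  have gnz: "g z \<noteq> 0" if "z \<in> ball 0 r" for z using gz[of z] g0 that by (cases "z = 0") auto
  \<comment> \<open>This is z f''/f', whose value at 0 is the order \<open>m\<close> of f'.\<close>
  define \<psi> where "\<psi> = (\<lambda>z. of_int m + z * deriv g z / g z)"
  have psi: "\<psi> holomorphic_on ball 0 r"
    unfolding \<psi>_def by (intro holomorphic_intros gh open_ball gnz) auto
  have op: "open (ball (0::complex) r - {0})" by (intro open_delete open_ball)
  have q: "deriv (deriv f) z / deriv f z = \<psi> z / z" if z: "z \<in> ball 0 r - {0}" for z
  proof -
    have z0: "z \<noteq> 0" using z by simp
    have dg: "(g has_field_derivative deriv g z) (at z)"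
      using gh z by (intro holomorphic_derivI[of _ "ball 0 r"]) auto
    have "((\<lambda>z. g z * z powi m) has_field_derivative
        deriv g z * z powi m + of_int m * z powi (m - 1) * g z) (at z)"
      using z0 by (auto intro!: derivative_eq_intros dg)
    then have "(deriv f has_field_derivative
        deriv g z * z powi m + of_int m * z powi (m - 1) * g z) (at z)"
      by (rule has_field_derivative_transform_within_open[OF _ op z]) (use gz in auto)
    then have "deriv (deriv f) z = deriv g z * z powi m + of_int m * z powi (m - 1) * g z"
      by (rule DERIV_imp_deriv)
    moreover have "z powi m = z powi (m - 1) * z"
      using z0 by (simp add: power_int_diff)
    ultimately show ?thesis
      using gz[of z] z z0 unfolding \<psi>_def by (simp add: field_simps)
  qed
  have k2: "k - 1 + 2 = k + 1" and k1: "k - 1 + 1 = k" using k by auto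
  obtain \<phi> where ph: "\<phi> holomorphic_on ball 0 r"
    and ph0: "\<phi> 0 = \<psi> 0 * (\<Prod>j=1..k-1. - of_nat j - \<psi> 0 / of_nat k)"
    and phS: "\<And>z. z \<in> ball 0 r - {0} \<Longrightarrow> S_aux k (k + 1) f z = \<phi> z / z ^ k"
    using S_aux_pole_form[where i = "k - 1" and k = k, OF psi q, unfolded k1 k2] by blast
  have "\<phi> 0 = 0"
  proof (rule ccontr)
    assume nz: "\<phi> 0 \<noteq> 0"
    have "filterlim (\<lambda>z::complex. z ^ k) (at 0) (at 0)"
      using k by (auto simp: filterlim_at intro!: tendsto_eq_intros eventually_neq_at_within)
    then have "is_pole (\<lambda>z. \<phi> z / z ^ k) 0"
      using nz ph r by (intro is_pole_divide) (auto simp: continuous_on_eq_continuous_at dest!: holomorphic_on_imp_continuous_on)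
    moreover have "is_pole (\<lambda>z. \<phi> z / z ^ k) 0 \<longleftrightarrow> is_pole (S_aux k (k + 1) f) 0"
    proof (rule is_pole_cong[OF _ refl])
      show "\<forall>\<^sub>F z in at 0. \<phi> z / z ^ k = S_aux k (k + 1) f z"
      using eventually_at_in_open[of "ball 0 r" "0::complex"] r phS by (auto elim!: eventually_mono simp del: S_aux.simps)
    qed
    ultimately show False using pole by simp
  qed
  then have "of_int m * (\<Prod>j=1..k-1. - of_nat j - of_int m / of_nat k) = (0::complex)"
    unfolding ph0 by (simp add: \<psi>_def)
  then have "m = 0 \<or> (\<exists>j. - of_nat j - of_int m / of_nat k = (0::complex))"
    by (auto simp: prod_zero_iff)
  \<comment> \<open>The factor with index j vanishes iff m = - j k, and m = 0 is the case i = 0. So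
    the origin is no zero of f', and the order of a pole is a multiple of \<open>k\<close>.\<close>
  then obtain i :: nat where i: "m = - int (i * k)"
  proof
    assume "m = 0" then show ?thesis using that[of 0] by simp
  next
    assume "\<exists>j. - of_nat j - of_int m / of_nat k = (0::complex)"
    then obtain j :: nat where "- of_nat j - of_int m / of_nat k = (0::complex)" by blast
    then have "of_int m = (of_int (- int (j * k)) :: complex)"
      using k by (simp add: field_simps add_eq_0_iff)
    then show ?thesis using that of_int_eq_iff by blast
  qed
  obtain L where L: "L holomorphic_on ball 0 r" "\<And>z. z \<in> ball 0 r \<Longrightarrow> g z = exp (L z)"
    using contractible_imp_holomorphic_log[OF gh convex_imp_contractible[OF convex_ball] gnz] by blast
  \<comment> \<open>A branch of f'^(-1/k): z^i is a k-th root of z^(-m), and the logarithm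
    \<open>L\<close> of the zero-free factor \<open>g\<close> supplies the rest.\<close>
  define w where "w = (\<lambda>z. z ^ i * exp (- L z / of_nat k))"
  have "w holomorphic_on ball 0 r"
    unfolding w_def using k by (intro holomorphic_intros L) auto
  moreover have "w z \<noteq> 0 \<and> deriv f z = 1 / w z ^ k" if z: "z \<in> ball 0 r - {0}" for z
  proof -
    have "exp (- L z / of_nat k) ^ k = exp (- L z)"
      using k by (simp add: exp_of_nat_mult[symmetric])
    then have wk: "w z ^ k = z ^ (i * k) / exp (L z)"
      by (simp add: w_def power_mult_distrib power_mult exp_minus field_simps)
    have "deriv f z = exp (L z) * z powi m" using gz[of z] L z by auto
    also have "z powi m = 1 / z ^ (i * k)"
      unfolding i by (simp only: power_int_minus power_int_of_nat inverse_eq_divide)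
    finally show ?thesis using z wk by (auto simp: w_def)
  qed
  ultimately show ?thesis using r by blast
qed

section \<open>Coefficient growth and continuation of solutions to the disk\<close>

text \<open>These are the Taylor coefficients of (1 - x)^(-(M+1)), whence the radius of convergence
  1.\<close>

definition majorant :: "real \<Rightarrow> nat \<Rightarrow> real" where
  "majorant M n = (\<Prod>j=1..n. 1 + M / real j)"

lemma majorant_Suc: "majorant M (Suc n) = majorant M n * (1 + M / real (Suc n))"
  by (simp add: majorant_def)

lemma majorant_ge_1: "M \<ge> 0 \<Longrightarrow> majorant M n \<ge> 1"
  unfolding majorant_def by (intro prod_ge_1) auto

lemma summable_majorant:
  assumes "M \<ge> 0" "0 \<le> r" "r < 1"
  shows "summable (\<lambda>n. majorant M n * r ^ n)"
proof -
  have "(\<lambda>n. 1 / (1 + M / real (Suc n))) \<longlonglongrightarrow> 1 / (1 + 0)"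
    by (intro tendsto_intros LIMSEQ_Suc[OF lim_const_over_n]) auto
  moreover have "norm (majorant M n) / norm (majorant M (Suc n)) = 1 / (1 + M / real (Suc n))" for n
    using majorant_ge_1[OF assms(1), of n] assms(1) unfolding majorant_Suc by (simp add: abs_mult)
  ultimately have "conv_radius (majorant M) = ereal 1"
    by (intro conv_radius_ratio_limit_nonzero) auto
  then show ?thesis using assms by (intro summable_in_conv_radius) auto
qed

text \<open>Following partial sums instead of coefficients collapses the recursion of order
  \<open>k\<close> to one step: the sum up to n - k is at most that up to n - 1, so for n >= k the
  n-th term enlarges the partial sum by a factor of at most 1 + M / n.\<close>

lemma partial_sums_le_majorant:
  fixes a :: "nat \<Rightarrow> complex"
  assumes M: "M \<ge> 0" and k: "k \<ge> 1"
    and rec: "\<And>n. real (n + k) * cmod (a (n + k)) \<le> M * (\<Sum>j\<le>n. cmod (a j))"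
  shows "(\<Sum>j\<le>n. cmod (a j)) \<le> (\<Sum>j<k. cmod (a j)) * majorant M n"
proof (induction n)
  case 0
  have "cmod (a 0) \<le> (\<Sum>j<k. cmod (a j))"
    using k by (intro member_le_sum) auto
  then show ?case by (simp add: majorant_def)
next
  case (Suc n)
  let ?b = "\<lambda>n. \<Sum>j\<le>n. cmod (a j)" and ?c = "\<Sum>j<k. cmod (a j)"
  show ?case
  proof (cases "Suc n < k")
    case True
    then have "?b (Suc n) \<le> ?c" by (intro sum_mono2) auto
    also have "\<dots> \<le> ?c * majorant M (Suc n)"
      using mult_left_mono[OF majorant_ge_1[OF M, of "Suc n"], of ?c] by (simp add: sum_nonneg)
    finally show ?thesis .
  next
    case False
    have "real (Suc n) * cmod (a (Suc n)) \<le> M * ?b (Suc n - k)"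
      using rec[of "Suc n - k"] False by simp
    also have "\<dots> \<le> M * ?b n"
      using M k by (intro mult_left_mono sum_mono2) auto
    finally have "?b (Suc n) \<le> ?b n * (1 + M / real (Suc n))"
      by (simp add: field_simps)
    also have "\<dots> \<le> ?c * majorant M n * (1 + M / real (Suc n))"
      using Suc.IH M by (intro mult_right_mono) auto
    finally show ?thesis by (simp only: majorant_Suc mult.assoc)
  qed
qed

text \<open>\<open>h\<close> is controlled only on the open disk, so Cauchy's inequality is applied
  on circles of radius r < 1, and then r tends to 1.\<close>

lemma higher_deriv_0_le_of_bounded:
  assumes h: "h holomorphic_on ball 0 1" and M: "\<And>z. z \<in> ball 0 1 \<Longrightarrow> cmod (h z) \<le> M"
  shows "cmod ((deriv ^^ n) h 0) \<le> fact n * M"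
proof -
  have "cmod ((deriv ^^ n) h 0) * r ^ n \<le> fact n * M" if r: "0 < r" "r < 1" for r
  proof -
    have "cball 0 r \<subseteq> ball (0::complex) 1" using r by auto
    then have "cmod ((deriv ^^ n) h 0) \<le> fact n * M / r ^ n"
      using r by (intro Cauchy_inequality)
        (auto intro!: M holomorphic_on_imp_continuous_on intro: holomorphic_on_subset[OF h] simp: dist_norm)
    then show ?thesis using r by (simp add: field_simps)
  qed
  then have "\<forall>\<^sub>F r in at_left (1::real). cmod ((deriv ^^ n) h 0) * r ^ n \<le> fact n * M"
    using eventually_at_left_real[of 0 "1::real"] by (auto elim!: eventually_mono)
  moreover have "((\<lambda>r. cmod ((deriv ^^ n) h 0) * r ^ n) \<longlongrightarrow> cmod ((deriv ^^ n) h 0) * 1 ^ n) (at_left (1::real))"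
    by (intro tendsto_intros)
  ultimately have "cmod ((deriv ^^ n) h 0) * 1 ^ n \<le> fact n * M"
    by (intro tendsto_upperbound) auto
  then show ?thesis by simp
qed

text \<open>The last clause normalises the initial data of the differential equation and will keep
  limits from vanishing; the growth bound, with constant 1 thanks to that normalisation, provides
  compactness.\<close>

definition normalized_solution :: "nat \<Rightarrow> real \<Rightarrow> (complex \<Rightarrow> complex) \<Rightarrow> bool" where
  "normalized_solution k M V \<longleftrightarrow> V holomorphic_on ball 0 1 \<and>
     (\<forall>z\<in>ball 0 1. cmod (V z) \<le> (\<Sum>n. majorant M n * cmod z ^ n)) \<and>
     (\<Sum>j<k. cmod ((deriv ^^ j) V 0 / fact j)) = 1"

text \<open>
  The Taylor coefficients of a local solution satisfy a recursion that keeps the power series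
  convergent on the whole disk, so no existence theorem for differential equations is needed.
\<close>

lemma linear_ode_solution_extends:
  assumes w: "w holomorphic_on ball 0 r" and r: "0 < r" "r \<le> 1" and k: "k \<ge> 1"
    and h: "h holomorphic_on ball 0 1" and M: "\<And>z. z \<in> ball 0 1 \<Longrightarrow> cmod (h z) \<le> M"
    and ode: "\<And>z. z \<in> ball 0 r \<Longrightarrow> (deriv ^^ k) w z = h z * w z"
    and nz: "\<exists>z\<in>ball 0 r. w z \<noteq> 0"
  shows "\<exists>V c. normalized_solution k M V \<and> c > 0 \<and> (\<forall>z\<in>ball 0 r. w z = complex_of_real c * V z)"
proof -
  define a where "a = (\<lambda>n. (deriv ^^ n) w 0 / fact n)"
  have M0: "M \<ge> 0" using M[of 0] norm_ge_zero[of "h 0"] by (simp del: norm_ge_zero)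
  have hr: "h holomorphic_on ball 0 r"
    using h by (rule holomorphic_on_subset) (use r in auto)
  have ev: "\<forall>\<^sub>F z in nhds 0. z \<in> ball (0::complex) r"
    using r by (intro eventually_nhds_in_open) auto
  \<comment> \<open>Leibniz' rule for the n-th derivative of h w at 0. The bound i! M for the
    derivatives of \<open>h\<close> cancels against the binomial coefficients, and all summands
    acquire the same factor n!.\<close>
  have rec: "real (n + k) * cmod (a (n + k)) \<le> M * (\<Sum>j\<le>n. cmod (a j))" for n
  proof -
    have "(deriv ^^ (n + k)) w 0 = (deriv ^^ n) ((deriv ^^ k) w) 0"
      by (simp add: funpow_add)
    also have "\<dots> = (deriv ^^ n) (\<lambda>z. h z * w z) 0"
      by (rule higher_deriv_cong_ev) (use ode in \<open>auto intro: eventually_mono[OF ev]\<close>)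
    also have "\<dots> = (\<Sum>i=0..n. of_nat (n choose i) * (deriv ^^ i) h 0 * (deriv ^^ (n - i)) w 0)"
      by (rule higher_deriv_mult[OF hr w open_ball]) (use r in auto)
    finally have "cmod ((deriv ^^ (n + k)) w 0) \<le>
        (\<Sum>i=0..n. cmod (of_nat (n choose i) * (deriv ^^ i) h 0 * (deriv ^^ (n - i)) w 0))"
      by (simp only: norm_sum)
    also have "\<dots> \<le> (\<Sum>i=0..n. fact n * (M * cmod (a (n - i))))"
    proof (rule sum_mono)
      fix i assume i: "i \<in> {0..n}"
      have "cmod (of_nat (n choose i) * (deriv ^^ i) h 0 * (deriv ^^ (n - i)) w 0)
          = real (n choose i) * cmod ((deriv ^^ i) h 0) * (fact (n - i) * cmod (a (n - i)))"
        by (simp add: norm_mult a_def norm_divide)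
      also have "\<dots> \<le> real (n choose i) * (fact i * M) * (fact (n - i) * cmod (a (n - i)))"
        by (intro mult_right_mono mult_left_mono higher_deriv_0_le_of_bounded h M) auto
      also have "\<dots> = (fact i * fact (n - i) * real (n choose i)) * (M * cmod (a (n - i)))"
        by (simp add: mult_ac)
      also have "fact i * fact (n - i) * real (n choose i) = fact n"
        using arg_cong[OF binomial_fact_lemma[of i n], of real] i by simp
      finally show "cmod (of_nat (n choose i) * (deriv ^^ i) h 0 * (deriv ^^ (n - i)) w 0)
          \<le> fact n * (M * cmod (a (n - i)))" .
    qed
    also have "\<dots> = fact n * (M * (\<Sum>i=0..n. cmod (a (n - i))))"
      by (simp add: sum_distrib_left)
    also have "(\<Sum>i=0..n. cmod (a (n - i))) = (\<Sum>j\<le>n. cmod (a j))"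
      by (rule sum.reindex_bij_witness[of _ "\<lambda>i. n - i" "\<lambda>i. n - i"]) auto
    finally have le: "cmod ((deriv ^^ (n + k)) w 0) \<le> fact n * (M * (\<Sum>j\<le>n. cmod (a j)))" .
    have "fact (n + k) = real (n + k) * fact (n + k - 1)"
      using k by (intro fact_reduce) simp
    then have "real (n + k) * cmod (a (n + k)) = cmod ((deriv ^^ (n + k)) w 0) / fact (n + k - 1)"
      using k by (simp only: a_def norm_divide norm_fact) simp
    also have "\<dots> \<le> fact n * (M * (\<Sum>j\<le>n. cmod (a j))) / fact (n + k - 1)"
      using le by (intro divide_right_mono) auto
    \<comment> \<open>As k >= 1, n! \<le> (n+k-1)!. Of the quotient (n+k)! / n! only the factor n +
      k is kept, which is enough for radius 1.\<close>
    also have "\<dots> \<le> fact (n + k - 1) * (M * (\<Sum>j\<le>n. cmod (a j))) / fact (n + k - 1)"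
      using k M0 by (intro divide_right_mono mult_right_mono fact_mono) (auto intro!: mult_nonneg_nonneg sum_nonneg)
    finally show ?thesis by simp
  qed
  define c where "c = (\<Sum>j<k. cmod (a j))"
  have a_le: "cmod (a n) \<le> c * majorant M n" for n
  proof -
    have "cmod (a n) \<le> (\<Sum>j\<le>n. cmod (a j))" by (intro member_le_sum) auto
    also have "\<dots> \<le> c * majorant M n"
      unfolding c_def by (rule partial_sums_le_majorant[OF M0 k rec])
    finally show ?thesis .
  qed
  have sums_w: "(\<lambda>n. a n * z ^ n) sums w z" if "z \<in> ball 0 r" for z
    using holomorphic_power_series[OF w that] by (simp add: a_def)
  \<comment> \<open>If the first \<open>k\<close> coefficients vanished, \<open>a_le\<close> would
    make all of them vanish, and \<open>w\<close> with them.\<close>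
  have c: "c > 0"
  proof (rule ccontr)
    assume "\<not> c > 0"
    moreover have "c \<ge> 0" unfolding c_def by (intro sum_nonneg) auto
    ultimately have "a n = 0" for n using a_le[of n] by simp
    then have "w z = 0" if "z \<in> ball 0 r" for z using sums_w[OF that] by (simp add: sums_iff)
    then show False using nz by blast
  qed
  define V where "V = (\<lambda>z. \<Sum>n. a n / of_real c * z ^ n)"
  have term_le: "norm (a n / of_real c * z ^ n) \<le> majorant M n * cmod z ^ n" for n z
  proof -
    have "cmod (a n) / c \<le> majorant M n" using a_le[of n] c by (simp add: field_simps)
    then show ?thesis
      using c mult_right_mono[of "cmod (a n) / c" "majorant M n" "cmod z ^ n"]
      by (simp add: norm_mult norm_divide norm_power)
  qed
  have summ: "summable (\<lambda>n. norm (a n / of_real c * z ^ n))" if "z \<in> ball 0 1" for z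
    by (rule summable_comparison_test'[OF summable_majorant[OF M0, of "cmod z"], of 0])
      (use that term_le in auto)
  have sums_V: "(\<lambda>n. a n / of_real c * (z - 0) ^ n) sums V z" if "z \<in> ball 0 1" for z
    unfolding V_def using summable_sums[OF summable_norm_cancel[OF summ[OF that]]] by simp
  have hol: "V holomorphic_on ball 0 1"
    using sums_V by (rule power_series_holomorphic)
  have wV: "w z = of_real c * V z" if z: "z \<in> ball 0 r" for z
  proof -
    have "(\<lambda>n. of_real c * (a n / of_real c * (z - 0) ^ n)) sums (of_real c * V z)"
      by (intro sums_mult sums_V) (use z r in auto)
    with sums_w[OF z] c show ?thesis by (simp add: sums_unique2)
  qed
  have dV: "(deriv ^^ j) V 0 / fact j = a j / of_real c" for j
  proof -
    have "(deriv ^^ j) w 0 = (deriv ^^ j) (\<lambda>z. of_real c * V z) 0"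
      by (rule higher_deriv_cong_ev) (use wV in \<open>auto intro: eventually_mono[OF ev]\<close>)
    also have "\<dots> = of_real c * (deriv ^^ j) V 0"
      by (rule higher_deriv_cmult[OF hol]) auto
    finally show ?thesis using c by (simp add: a_def)
  qed
  have "(\<Sum>j<k. cmod ((deriv ^^ j) V 0 / fact j)) = (\<Sum>j<k. cmod (a j) / c)"
    unfolding dV using c by (simp add: norm_divide)
  also have "\<dots> = 1" using c by (simp add: sum_divide_distrib[symmetric] c_def)
  finally have "(\<Sum>j<k. cmod ((deriv ^^ j) V 0 / fact j)) = 1" .
  moreover have "cmod (V z) \<le> (\<Sum>n. majorant M n * cmod z ^ n)" if z: "z \<in> ball 0 1" for z
  proof -
    have "cmod (V z) \<le> (\<Sum>n. norm (a n / of_real c * z ^ n))"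
      unfolding V_def by (rule summable_norm[OF summ[OF z]])
    also have "\<dots> \<le> (\<Sum>n. majorant M n * cmod z ^ n)"
      by (intro suminf_le term_le summ[OF z] summable_majorant M0) (use z in auto)
    finally show ?thesis .
  qed
  ultimately show ?thesis
    using hol c wV by (intro exI[of _ V] exI[of _ c]) (auto simp: normalized_solution_def)
qed

section \<open>From the bound on the Schwarzian to a representation of f'\<close>

lemma meromorphic_S_aux: "f meromorphic_on A \<Longrightarrow> S_aux n j f meromorphic_on A"
  by (induction j) (auto intro!: meromorphic_intros)

text \<open>The convention for S_k excludes sphere-valued constants, whereas the order of f' at the
  origin requires f' not to vanish identically nearby; this bridges the two. Local vanishing of f'
  spreads by the identity theorem, and \<open>D\<close> stays connected without the sparse set of
  bad points.\<close>

lemma meromorphic_deriv_zero_imp_constant: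
  assumes mero: "f meromorphic_on D" and D: "open D" "connected D" and z0: "z0 \<in> D"
    and ev: "\<forall>\<^sub>F z in at z0. deriv f z = 0"
  shows "sphere_value f constant_on D"
proof -
  have "\<not> (\<forall>\<^sub>\<approx>z\<in>D. deriv f z \<noteq> 0)"
  proof
    assume "\<forall>\<^sub>\<approx>z\<in>D. deriv f z \<noteq> 0"
    then have "\<forall>\<^sub>F z in at z0. deriv f z \<noteq> 0"
      using z0 by (rule eventually_cosparse_imp_eventually_at)
    with ev have "\<forall>\<^sub>F z in at z0. False" by eventually_elim simp
    then show False by simp
  qed
  then have "\<forall>\<^sub>\<approx>z\<in>D. deriv f z = 0"
    using meromorphic_imp_constant_or_avoid[OF meromorphic_on_deriv[OF mero] D, of 0] by blast
  with meromorphic_on_imp_analytic_cosparse[OF mero]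
  have cosp: "\<forall>\<^sub>\<approx>z\<in>D. f analytic_on {z} \<and> deriv f z = 0"
    by eventually_elim simp
  define X where "X = {z. \<not> (f analytic_on {z} \<and> deriv f z = 0)}"
  have X: "X sparse_in D" using cosp unfolding eventually_cosparse X_def .
  have "f constant_on (D - X)"
  proof (rule has_field_derivative_0_imp_constant_on)
    fix z assume "z \<in> D - X"
    then show "(f has_field_derivative 0) (at z)"
      unfolding X_def using analytic_derivI[of f z] by auto
  qed (use sparse_imp_connected[OF _ D(2,1) X] open_diff_sparse_pts[OF D(1) X] in auto)
  then obtain c where c: "\<And>z. z \<in> D - X \<Longrightarrow> f z = c" unfolding constant_on_def by blast
  have "sphere_value f z = Some c" if z: "z \<in> D" for z
  proof (rule sphere_value_eq_Some)
    have "\<forall>\<^sub>F w in at z. f analytic_on {w} \<and> deriv f w = 0"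
      using cosp z by (rule eventually_cosparse_imp_eventually_at)
    moreover have "\<forall>\<^sub>F w in at z. w \<in> D" using D(1) z by (rule eventually_at_in_open')
    ultimately show "\<forall>\<^sub>F w in at z. f w = c"
      by eventually_elim (auto intro!: c simp: X_def)
  qed simp
  then show ?thesis unfolding constant_on_def by blast
qed

text \<open>A pole of f would be a pole of f', which has a finite limit. So the singularity is
  removable, and continuity of the derivative of the extension fixes its value.\<close>

lemma remove_sings_has_derivative:
  assumes mero: "f meromorphic_on {z}" and ev: "\<forall>\<^sub>F w in at z. deriv f w = g w" and g: "isCont g z"
  shows "(remove_sings f has_field_derivative g z) (at z)"
proof -
  have lim: "deriv f \<midarrow>z\<rightarrow> g z"
    using ev g by (metis isContD tendsto_cong)
  then have "\<not> is_pole (deriv f) z"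
    using not_tendsto_and_filterlim_at_infinity[of "at z" "deriv f"] by (auto simp: is_pole_def)
  then have "\<not> is_pole f z" using is_pole_deriv_iff[OF mero] by simp
  then obtain c where "f \<midarrow>z\<rightarrow> c"
    using meromorphic_on_not_essential[OF mero] unfolding not_essential_def by blast
  then have ana: "remove_sings f analytic_on {z}"
    using remove_sings_analytic_at meromorphic_on_isolated_singularity[OF mero] by blast
  have "\<forall>\<^sub>F w in at z. f analytic_on {w}"
    using meromorphic_on_imp_analytic_cosparse[OF mero] by (rule eventually_cosparse_imp_eventually_at) simp
  then have "\<forall>\<^sub>F w in at z. deriv (remove_sings f) w = deriv f w"
    by eventually_elim simp
  then have "deriv (remove_sings f) \<midarrow>z\<rightarrow> g z"
    using lim tendsto_cong by metis
  moreover have "isCont (deriv (remove_sings f)) z"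
    using analytic_deriv[OF ana] by (rule analytic_at_imp_isCont)
  then have "deriv (remove_sings f) \<midarrow>z\<rightarrow> deriv (remove_sings f) z"
    by (rule isContD)
  ultimately have "deriv (remove_sings f) z = g z" by (intro LIM_unique)
  then show ?thesis using analytic_derivI[OF ana] by simp
qed

lemma schwarzian_family_bound:
  assumes "f \<in> schwarzian_family k M" "z \<in> unit_disk"
  shows "\<not> sphere_value f constant_on unit_disk \<and> \<not> is_pole (S_aux k (k + 1) f) z
    \<and> cmod (remove_sings (S_aux k (k + 1) f) z) \<le> M"
proof -
  let ?g = "generalized_schwarzian k f"
  have "(case ?g z of None \<Rightarrow> \<infinity> | Some w \<Rightarrow> ereal (cmod w)) \<le> disk_sup_norm ?g"
    unfolding disk_sup_norm_def using assms(2) by (rule SUP_upper)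
  also have "\<dots> \<le> ereal M" using assms(1) by (simp add: schwarzian_family_def)
  finally show ?thesis
    by (auto simp: generalized_schwarzian_def sphere_value_def simp del: S_aux.simps split: if_splits)
qed

text \<open>f' = B / V^k in product form and on punctured neighbourhoods, so that it can be stated
  at the zeros of \<open>V\<close>, where f' has poles.\<close>

definition represents :: "nat \<Rightarrow> (complex \<Rightarrow> complex) \<Rightarrow> complex \<Rightarrow> (complex \<Rightarrow> complex) \<Rightarrow> bool" where
  "represents k V B f \<longleftrightarrow> f meromorphic_on unit_disk \<and> B \<noteq> 0 \<and>
     (\<forall>z\<in>unit_disk. \<forall>\<^sub>F w in at z. deriv f w * V w ^ k = B)"

text \<open>Only the origin needs local analysis: it yields the root \<open>w\<close>, the
  differential equation extends \<open>w\<close> up to a factor to \<open>V\<close> on the disk, and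
  the identity for f' V^k spreads from there.\<close>

lemma schwarzian_family_representation:
  assumes f: "f \<in> schwarzian_family k M" and k: "k \<ge> 1"
  shows "\<exists>V B. normalized_solution k M V \<and> represents k V B f"
proof -
  define S where "S = S_aux k (k + 1) f"
  have mero: "f meromorphic_on unit_disk" using f by (simp add: schwarzian_family_def)
  note bound = schwarzian_family_bound[OF f, folded S_def]
  have zero: "0 \<in> unit_disk" by simp
  have mero0: "f meromorphic_on {0}" using mero by (rule meromorphic_on_subset) simp
  have "\<exists>\<^sub>F z in at 0. deriv f z \<noteq> 0"
    unfolding frequently_def
    using meromorphic_deriv_zero_imp_constant[OF mero open_ball connected_ball zero] bound[OF zero] by auto
  then obtain r0 w where r0: "r0 > 0" and w0: "w holomorphic_on ball 0 r0"
    and wz: "\<And>z. z \<in> ball 0 r0 - {0} \<Longrightarrow> w z \<noteq> 0 \<and> deriv f z = 1 / w z ^ k"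
    using derivative_eq_inverse_power_near_0[OF mero0 _ _ k] bound[OF zero, unfolded S_def] by blast
  define r where "r = min r0 1"
  have r: "r > 0" "r \<le> 1" using r0 by (auto simp: r_def)
  have w: "w holomorphic_on ball 0 r" using w0 by (rule holomorphic_on_subset) (auto simp: r_def)
  define U where "U = ball (0::complex) r - {0}"
  have U: "open U" unfolding U_def by (intro open_delete open_ball)
  have wU: "w holomorphic_on U" using w by (rule holomorphic_on_subset) (auto simp: U_def)
  have Uz: "w z \<noteq> 0" "deriv f z = 1 / w z ^ k" if "z \<in> U" for z
    using wz[of z] that by (auto simp: U_def r_def)
  have q: "deriv (deriv f) z / deriv f z = - of_nat k * deriv w z / w z" if z: "z \<in> U" for z
  proof -
    have "((\<lambda>z. 1 / w z ^ k) has_field_derivative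
        - (of_nat k * (deriv w z * w z ^ (k - 1))) / (w z ^ k * w z ^ k)) (at z)"
      using DERIV_divide[OF DERIV_const[of 1] DERIV_power[OF holomorphic_derivI[OF wU U z], of k]] Uz[OF z]
      by simp
    then have "(deriv f has_field_derivative
        - (of_nat k * (deriv w z * w z ^ (k - 1))) / (w z ^ k * w z ^ k)) (at z)"
      by (rule has_field_derivative_transform_within_open[OF _ U z]) (use Uz in auto)
    then have D: "deriv (deriv f) z = - (of_nat k * (deriv w z * w z ^ (k - 1))) / (w z ^ k * w z ^ k)"
      by (rule DERIV_imp_deriv)
    have "w z ^ k = w z * w z ^ (k - 1)" using k by (cases k) auto
    then show ?thesis unfolding D Uz(2)[OF z] using Uz(1)[OF z] by (simp add: field_simps)
  qed
  have S_eq: "S z = - of_nat k * (deriv ^^ k) w z / w z" if "z \<in> U" for z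
  proof -
    have "k - 1 + 2 = k + 1" "k - 1 + 1 = k" using k by auto
    then show ?thesis
      using S_aux_root_form[OF wU U Uz(1) k q that, of "k - 1"] unfolding S_def by metis
  qed
  have Smero: "S meromorphic_on unit_disk" unfolding S_def using mero by (rule meromorphic_S_aux)
  have S_ana: "remove_sings S analytic_on {z}" if z: "z \<in> unit_disk" for z
  proof -
    have m: "S meromorphic_on {z}" using Smero by (rule meromorphic_on_subset) (use z in auto)
    obtain c where "S \<midarrow>z\<rightarrow> c"
      using meromorphic_on_not_essential[OF m] bound[OF z] unfolding not_essential_def by blast
    then show ?thesis using remove_sings_analytic_at meromorphic_on_isolated_singularity[OF m] by blast
  qed
  then have S_hol: "remove_sings S holomorphic_on unit_disk"
    using analytic_on_analytic_at analytic_imp_holomorphic by blast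
  \<comment> \<open>From S = - k w^(k) / w the coefficient of the equation is - S / k; the bound M
    survives since k >= 1.\<close>
  define h where "h = (\<lambda>z. - (1 / of_nat k) * remove_sings S z)"
  have h: "h holomorphic_on unit_disk" unfolding h_def by (intro holomorphic_intros S_hol)
  have hM: "cmod (h z) \<le> M" if "z \<in> unit_disk" for z
  proof -
    have "cmod (h z) = cmod (remove_sings S z) / real k" by (simp add: h_def norm_mult norm_divide)
    also have "\<dots> \<le> cmod (remove_sings S z) / 1" using k by (intro divide_left_mono) auto
    finally show ?thesis using bound[OF that] by simp
  qed
  have odeU: "(deriv ^^ k) w z = h z * w z" if z: "z \<in> U" for z
  proof -
    have dw: "(deriv ^^ k) w holomorphic_on U" by (rule holomorphic_higher_deriv[OF wU U])
    have "(\<lambda>z. - of_nat k * (deriv ^^ k) w z / w z) holomorphic_on U"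
      by (intro holomorphic_intros dw wU Uz(1))
    then have "isCont (\<lambda>z. - of_nat k * (deriv ^^ k) w z / w z) z"
      using holomorphic_on_imp_continuous_on U z continuous_on_eq_continuous_at by blast
    moreover have "\<forall>\<^sub>F y in at z. - of_nat k * (deriv ^^ k) w y / w y = S y"
      using eventually_at_in_open'[OF U z] by eventually_elim (simp add: S_eq)
    ultimately have "S \<midarrow>z\<rightarrow> - of_nat k * (deriv ^^ k) w z / w z"
      using isContD Lim_transform_eventually by blast
    then have "remove_sings S z = - of_nat k * (deriv ^^ k) w z / w z" by (rule remove_sings_eqI)
    then show ?thesis using Uz(1)[OF z] k by (simp add: h_def)
  qed
  \<comment> \<open>The origin is reached by continuity, because \<open>w\<close> vanishes there
    whenever f' has a pole.\<close>
  have ode: "(deriv ^^ k) w z = h z * w z" if z: "z \<in> ball 0 r" for z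
  proof (cases "z = 0")
    case True
    have dw: "(deriv ^^ k) w holomorphic_on ball 0 r" by (rule holomorphic_higher_deriv[OF w open_ball])
    have hr: "h holomorphic_on ball 0 r" using h by (rule holomorphic_on_subset) (use r in auto)
    have "(\<lambda>z. (deriv ^^ k) w z - h z * w z) holomorphic_on ball 0 r"
      by (intro holomorphic_intros dw hr w)
    then have "isCont (\<lambda>z. (deriv ^^ k) w z - h z * w z) 0"
      using holomorphic_on_imp_continuous_on open_ball z True continuous_on_eq_continuous_at by blast
    then have "(\<lambda>z. (deriv ^^ k) w z - h z * w z) \<midarrow>0\<rightarrow> (deriv ^^ k) w 0 - h 0 * w 0"
      by (rule isContD)
    moreover have "\<forall>\<^sub>F y in at 0. (deriv ^^ k) w y - h y * w y = 0"
      using eventually_at_in_open[OF open_ball, of 0 0 r] r by (auto elim!: eventually_mono simp: odeU U_def)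
    then have "(\<lambda>z. (deriv ^^ k) w z - h z * w z) \<midarrow>0\<rightarrow> 0" by (rule tendsto_eventually)
    ultimately have "(deriv ^^ k) w 0 - h 0 * w 0 = 0" by (rule LIM_unique)
    then show ?thesis using True by simp
  qed (use z odeU in \<open>auto simp: U_def\<close>)
  have "of_real (r / 2) \<in> U" using r by (auto simp: U_def)
  then have "\<exists>z\<in>ball 0 r. w z \<noteq> 0" using Uz(1) unfolding U_def by blast
  then obtain V c where V: "normalized_solution k M V" and c: "c > 0"
    and wV: "\<And>z. z \<in> ball 0 r \<Longrightarrow> w z = complex_of_real c * V z"
    using linear_ode_solution_extends[OF w r k h hM ode] by blast
  define B where "B = 1 / complex_of_real c ^ k"
  have Vh: "V holomorphic_on unit_disk" using V by (simp add: normalized_solution_def)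
  have "V meromorphic_on unit_disk"
    using Vh by (intro analytic_on_imp_meromorphic_on) (simp add: analytic_on_open)
  then have m: "(\<lambda>z. deriv f z * V z ^ k) meromorphic_on unit_disk"
    using mero by (intro meromorphic_intros)
  have near0: "\<forall>\<^sub>F z in at 0. deriv f z * V z ^ k = B"
  proof -
    have "\<forall>\<^sub>F z in at 0. z \<in> U"
      unfolding U_def using r by (intro eventually_at_in_open) auto
    then show ?thesis
    proof eventually_elim
      case (elim z)
      then have "w z = complex_of_real c * V z" using wV by (auto simp: U_def)
      then show ?case using Uz[OF elim] c by (simp add: B_def power_mult_distrib)
    qed
  qed
  \<comment> \<open>A meromorphic function on the disk equals \<open>B\<close> off a sparse set or
    avoids \<open>B\<close> off a sparse set; \<open>near0\<close> excludes the latter.\<close>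
  have "\<not> (\<forall>\<^sub>\<approx>z\<in>unit_disk. deriv f z * V z ^ k \<noteq> B)"
  proof
    assume "\<forall>\<^sub>\<approx>z\<in>unit_disk. deriv f z * V z ^ k \<noteq> B"
    then have "\<forall>\<^sub>F z in at 0. deriv f z * V z ^ k \<noteq> B"
      by (rule eventually_cosparse_imp_eventually_at) simp
    with near0 have "\<forall>\<^sub>F z in at (0::complex). False" by eventually_elim simp
    then show False by simp
  qed
  then have "\<forall>\<^sub>\<approx>z\<in>unit_disk. deriv f z * V z ^ k = B"
    using meromorphic_imp_constant_or_avoid[OF m open_ball connected_ball, of B] by blast
  then have "\<forall>z\<in>unit_disk. \<forall>\<^sub>F z in at z. deriv f z * V z ^ k = B"
    by (blast intro: eventually_cosparse_imp_eventually_at)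
  then have "represents k V B f" using c mero by (simp add: represents_def B_def)
  then show ?thesis using V by blast
qed

section \<open>Quasi-normality\<close>

lemma normalized_subsequence:
  fixes A B :: "nat \<Rightarrow> complex"
  assumes B: "\<And>n. B n \<noteq> 0"
  defines "N \<equiv> \<lambda>n. norm (A n, B n)"
  shows "\<exists>s \<alpha> \<beta>. strict_mono s \<and> (\<lambda>n. A (s n) / of_real (N (s n))) \<longlonglongrightarrow> \<alpha> \<and>
           (\<lambda>n. B (s n) / of_real (N (s n))) \<longlonglongrightarrow> \<beta> \<and> (\<alpha> \<noteq> 0 \<or> \<beta> \<noteq> 0) \<and>
           (convergent (\<lambda>n. N (s n)) \<or> filterlim (\<lambda>n. N (s n)) at_top sequentially)"
proof -
  have N: "N n > 0" for n using B[of n] by (simp add: N_def zero_prod_def)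
  \<comment> \<open>The direction of (A, B) lies on the unit sphere, so its limit cannot be (0, 0).
    The last coordinate compactifies the scale: its limit is 0 iff \<open>N\<close> tends to
    infinity along the subsequence, and otherwise \<open>N\<close> converges, possibly to 0.\<close>
  define x where "x = (\<lambda>n. (((1 / N n) *\<^sub>R (A n, B n)), 1 / (1 + N n)))"
  have "compact (sphere (0::complex \<times> complex) 1 \<times> {0..1::real})"
    by (intro compact_Times compact_sphere compact_Icc)
  moreover have "x n \<in> sphere 0 1 \<times> {0..1}" for n
  proof -
    have "norm ((1 / N n) *\<^sub>R (A n, B n)) = 1" using N[of n] unfolding norm_scaleR N_def by simp
    moreover have "1 / (1 + N n) \<in> {0..1}" using N[of n] by simp
    ultimately show ?thesis by (simp only: x_def mem_Times_iff fst_conv snd_conv mem_sphere_0 simp_thms)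
  qed
  ultimately obtain l s where l: "l \<in> sphere (0::complex \<times> complex) 1 \<times> {0..1::real}" and s: "strict_mono s"
    and lim: "(x \<circ> s) \<longlonglongrightarrow> l"
    unfolding compact_def by (elim allE[of _ x]) blast
  obtain \<alpha> \<beta> \<tau> where l': "l = ((\<alpha>, \<beta>), \<tau>)" by (metis prod.collapse)
  have "(\<lambda>n. fst (fst (x (s n)))) \<longlonglongrightarrow> \<alpha>" "(\<lambda>n. snd (fst (x (s n)))) \<longlonglongrightarrow> \<beta>" "(\<lambda>n. snd (x (s n))) \<longlonglongrightarrow> \<tau>"
    using tendsto_fst[OF tendsto_fst[OF lim]] tendsto_snd[OF tendsto_fst[OF lim]] tendsto_snd[OF lim]
    by (simp_all add: l' o_def)
  then have a: "(\<lambda>n. A (s n) / of_real (N (s n))) \<longlonglongrightarrow> \<alpha>" and b: "(\<lambda>n. B (s n) / of_real (N (s n))) \<longlonglongrightarrow> \<beta>"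
    and t: "(\<lambda>n. 1 / (1 + N (s n))) \<longlonglongrightarrow> \<tau>"
    by (simp_all add: x_def scaleR_conv_of_real divide_inverse mult.commute)
  have "norm (\<alpha>, \<beta>) = 1" using l by (simp add: l')
  then have ab: "\<alpha> \<noteq> 0 \<or> \<beta> \<noteq> 0" by auto
  have "convergent (\<lambda>n. N (s n)) \<or> filterlim (\<lambda>n. N (s n)) at_top sequentially"
  proof (cases "\<tau> = 0")
    case True
    have "filterlim (\<lambda>n. inverse (1 / (1 + N (s n)))) at_top sequentially"
      using t True N by (intro filterlim_inverse_at_top) (auto intro!: always_eventually add_pos_pos)
    from filterlim_tendsto_add_at_top[OF tendsto_const[of "-1"] this] show ?thesis by simp
  next
    case False
    have "(\<lambda>n. inverse (1 / (1 + N (s n))) - 1) \<longlonglongrightarrow> inverse \<tau> - 1"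
      by (intro tendsto_intros t False)
    then show ?thesis by (auto simp: convergent_def)
  qed
  then show ?thesis using s a b ab by blast
qed

text \<open>If \<open>N\<close> converges, even to 0, the limit is finite. If \<open>N\<close> tends
  to infinity, \<open>h\<close> must be zero-free, for near a zero of \<open>h\<close> the product
  need not become large.\<close>

lemma spherical_limit_scaled:
  assumes U: "open U" and H: "compact_limit U H h" and h: "continuous_on U h" "\<And>z. z \<in> U \<Longrightarrow> h z \<noteq> 0"
    and N: "convergent N \<or> filterlim N at_top sequentially"
    and val: "\<And>K. compact K \<Longrightarrow> K \<subseteq> U \<Longrightarrow>
      \<forall>\<^sub>F n in sequentially. \<forall>z\<in>K. sphere_value (f n) z = Some (complex_of_real (N n) * H n z)"
  shows "\<exists>g. spherical_locally_uniform_limit U (\<lambda>n. sphere_value (f n)) g"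
  using N
proof
  assume "convergent N"
  then obtain l where "N \<longlonglongrightarrow> l" by (auto simp: convergent_def)
  then have "(\<lambda>n. complex_of_real (N n)) \<longlonglongrightarrow> of_real l" by (rule tendsto_of_real)
  then have "compact_limit U (\<lambda>n z. complex_of_real (N n) * H n z) (\<lambda>z. of_real l * h z)"
    by (intro compact_limit_mult compact_limit_const H h continuous_on_const)
  then show ?thesis using spherical_limit_finite[OF U _ val] by blast
next
  assume N: "filterlim N at_top sequentially"
  have "spherical_locally_uniform_limit U (\<lambda>n. sphere_value (f n)) (\<lambda>_. None)"
  proof (rule spherical_limit_infinite[OF U _ val])
    fix K R assume K: "compact K" "K \<subseteq> U"
    obtain b where b: "b > 0" and ev: "\<forall>\<^sub>F n in sequentially. \<forall>z\<in>K. b \<le> cmod (H n z)"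
      using compact_limit_eventually_bounded_away[OF H h K] by blast
    have "\<forall>\<^sub>F n in sequentially. N n > max 0 (R / b)"
      using N unfolding filterlim_at_top_dense by blast
    then show "\<forall>\<^sub>F n in sequentially. \<forall>z\<in>K. R < cmod (complex_of_real (N n) * H n z)"
      using ev
    proof eventually_elim
      case (elim n)
      show ?case
      proof
        fix z assume "z \<in> K"
        have "R < N n * b" using elim(1) b by (simp add: field_simps)
        also have "\<dots> \<le> N n * cmod (H n z)" using elim \<open>z \<in> K\<close> by (intro mult_left_mono) auto
        finally show "R < cmod (complex_of_real (N n) * H n z)" using elim(1) by (simp add: norm_mult)
      qed
    qed
  qed
  then show ?thesis by blast
qed

lemma spherical_limit_subseq:
  assumes "spherical_locally_uniform_limit U F g" "strict_mono s"
  shows "spherical_locally_uniform_limit U (\<lambda>n. F (s n)) g"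
  unfolding spherical_locally_uniform_limit_def
proof
  fix z assume "z \<in> U"
  then obtain r where "r > 0" and r: "\<And>\<epsilon>. \<epsilon> > 0 \<Longrightarrow>
      \<forall>\<^sub>F n in sequentially. \<forall>w\<in>ball z r \<inter> U. spherical_dist (F n w) (g w) < \<epsilon>"
    using assms(1) unfolding spherical_locally_uniform_limit_def by meson
  then show "\<exists>r>0. \<forall>\<epsilon>>0. \<forall>\<^sub>F n in sequentially. \<forall>w\<in>ball z r \<inter> U. spherical_dist (F (s n) w) (g w) < \<epsilon>"
    using eventually_subseq[OF assms(2)] by meson
qed

lemma quasi_normal_on_image:
  assumes mero: "\<And>f. f \<in> \<F> \<Longrightarrow> \<Phi> f meromorphic_on D"
    and lim: "\<And>f :: nat \<Rightarrow> complex \<Rightarrow> complex. (\<And>n. f n \<in> \<F>) \<Longrightarrow> \<exists>s E g. strict_mono s \<and> no_accumulation_in E D \<and>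
      spherical_locally_uniform_limit (D - E) (\<lambda>n. sphere_value (\<Phi> (f (s n)))) g"
  shows "quasi_normal_on {\<Phi> f | f. f \<in> \<F>} D"
  unfolding quasi_normal_on_def
proof (intro conjI allI impI)
  show "\<forall>f\<in>{\<Phi> f | f. f \<in> \<F>}. f meromorphic_on D" using mero by blast
  fix F :: "nat \<Rightarrow> complex \<Rightarrow> complex" assume F: "range F \<subseteq> {\<Phi> f | f. f \<in> \<F>}"
  then have "\<forall>n. \<exists>f. F n = \<Phi> f \<and> f \<in> \<F>" by blast
  then obtain f where f: "\<And>n. F n = \<Phi> (f n)" "\<And>n. f n \<in> \<F>" by metis
  show "\<exists>s. strict_mono s \<and> (\<exists>E g. no_accumulation_in E D \<and>
          spherical_locally_uniform_limit (D - E) (\<lambda>n. sphere_value (F (s n))) g)"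
    using lim[of f, OF f(2)] unfolding f(1) by blast
qed

text \<open>Finiteness of the limit lets one property serve two claims: it gives quasi-normality,
  and it contradicts convergence of a sequence to infinity by way of a subsequence. \<open>F\<close>
  carries the analytic formulas, as the raw values of \<open>\<Phi> (f (s n))\<close> at
  singularities are arbitrary.\<close>

definition finite_subsequential_limits ::
    "(complex \<Rightarrow> complex) set \<Rightarrow> ((complex \<Rightarrow> complex) \<Rightarrow> complex \<Rightarrow> complex) \<Rightarrow> complex set \<Rightarrow> bool" where
  "finite_subsequential_limits \<F> \<Phi> D \<longleftrightarrow> (\<forall>f :: nat \<Rightarrow> complex \<Rightarrow> complex. (\<forall>n. f n \<in> \<F>) \<longrightarrow>
     (\<exists>s E F g. strict_mono s \<and> no_accumulation_in E D \<and> open (D - E) \<and> compact_limit (D - E) F g \<and>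
       (\<forall>K. compact K \<longrightarrow> K \<subseteq> D - E \<longrightarrow>
         (\<forall>\<^sub>F n in sequentially. \<forall>z\<in>K. sphere_value (\<Phi> (f (s n))) z = Some (F n z)))))"

lemma finite_subsequential_limits_quasi_normal:
  assumes mero: "\<And>f. f \<in> \<F> \<Longrightarrow> \<Phi> f meromorphic_on D"
    and fin: "finite_subsequential_limits \<F> \<Phi> D" and D: "open D" "D \<noteq> {}"
  shows "quasi_normal_on {\<Phi> f | f. f \<in> \<F>} D \<and>
    (\<nexists>F. range F \<subseteq> {\<Phi> f | f. f \<in> \<F>} \<and> converges_to_infinity_on F D)"
proof
  show "quasi_normal_on {\<Phi> f | f. f \<in> \<F>} D"
  proof (rule quasi_normal_on_image[OF mero])
    fix f :: "nat \<Rightarrow> complex \<Rightarrow> complex" assume "\<And>n. f n \<in> \<F>"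
    then obtain s E F g where s: "strict_mono s" "no_accumulation_in E D" "open (D - E)" "compact_limit (D - E) F g"
      and val: "\<And>K. compact K \<Longrightarrow> K \<subseteq> D - E \<Longrightarrow>
         \<forall>\<^sub>F n in sequentially. \<forall>z\<in>K. sphere_value (\<Phi> (f (s n))) z = Some (F n z)"
      using fin unfolding finite_subsequential_limits_def by meson
    show "\<exists>s E g. strict_mono s \<and> no_accumulation_in E D \<and>
      spherical_locally_uniform_limit (D - E) (\<lambda>n. sphere_value (\<Phi> (f (s n)))) g"
      using spherical_limit_finite[OF s(3,4) val] s by blast
  qed
  show "\<nexists>F. range F \<subseteq> {\<Phi> f | f. f \<in> \<F>} \<and> converges_to_infinity_on F D"
  proof
    assume "\<exists>F. range F \<subseteq> {\<Phi> f | f. f \<in> \<F>} \<and> converges_to_infinity_on F D"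
    then obtain F where F: "range F \<subseteq> {\<Phi> f | f. f \<in> \<F>}" "converges_to_infinity_on F D" by blast
    then have "\<forall>n. \<exists>f. F n = \<Phi> f \<and> f \<in> \<F>" by blast
    then obtain f where f: "\<And>n. F n = \<Phi> (f n)" "\<And>n. f n \<in> \<F>" by metis
    obtain s E H g where s: "strict_mono s" "no_accumulation_in E D" "compact_limit (D - E) H g"
      and val: "\<And>K. compact K \<Longrightarrow> K \<subseteq> D - E \<Longrightarrow>
         \<forall>\<^sub>F n in sequentially. \<forall>z\<in>K. sphere_value (\<Phi> (f (s n))) z = Some (H n z)"
      using fin f(2) unfolding finite_subsequential_limits_def by meson
    obtain E' where E': "no_accumulation_in E' D"
      and inf: "spherical_locally_uniform_limit (D - E') (\<lambda>n. sphere_value (\<Phi> (f n))) (\<lambda>_. None)"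
      using F(2) unfolding converges_to_infinity_on_def f(1) by blast
    obtain z0 where z0: "z0 \<in> D" using D by blast
    \<comment> \<open>Neither exceptional set accumulates at \<open>z0\<close>, so together they
      cannot cover the open set \<open>D\<close>; a point outside both sees both limits.\<close>
    have "\<not> z0 islimpt (E \<union> E')"
      using s(2) E' z0 by (auto simp: no_accumulation_in_def islimpt_Un)
    moreover have "z0 islimpt D" using D(1) z0 by (rule interior_limit_point[OF subsetD[OF interior_maximal[OF subset_refl]]])
    ultimately have "\<not> D \<subseteq> E \<union> E'" using islimpt_subset by blast
    then obtain z where "z \<in> D - E" "z \<in> D - E'" by blast
    then show False
      using spherical_limit_unique_finite[OF s(3) val spherical_limit_subseq[OF inf s(1)]] by blast
  qed
qed

text \<open>Off the zeros of \<open>V\<close> the derivative has a finite limit, so f has at most a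
  removable singularity and \<open>remove_sings f\<close> is the true function. In f''/f' the
  constant \<open>B\<close> cancels.\<close>

lemma represents_values:
  assumes rep: "represents k V B f" and V: "V holomorphic_on unit_disk"
    and z: "z \<in> unit_disk" and nz: "V z \<noteq> 0"
  shows "(remove_sings f has_field_derivative B / V z ^ k) (at z)"
    and "sphere_value f z = Some (remove_sings f z)"
    and "sphere_value (deriv f) z = Some (B / V z ^ k)"
    and "k \<ge> 1 \<Longrightarrow> sphere_value (\<lambda>z. deriv (deriv f) z / deriv f z) z = Some (- of_nat k * deriv V z / V z)"
    and "remove_sings f z \<noteq> 0 \<Longrightarrow>
      sphere_value (\<lambda>z. deriv f z / f z) z = Some (B / V z ^ k / remove_sings f z)"
proof -
  have mero: "f meromorphic_on {z}" and B: "B \<noteq> 0"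
    using rep z by (auto simp: represents_def intro: meromorphic_on_subset)
  have contV: "continuous_on unit_disk V" using V by (rule holomorphic_on_imp_continuous_on)
  define T where "T = {w \<in> unit_disk. V w \<noteq> 0}"
  have "T = unit_disk \<inter> V -` (- {0})" by (auto simp: T_def)
  then have T: "open T" "z \<in> T"
    using continuous_open_preimage[OF contV open_ball, of "- {0}"] z nz by (auto simp: T_def)
  have VT: "V holomorphic_on T" using V by (rule holomorphic_on_subset) (auto simp: T_def)
  have "\<forall>\<^sub>F w in at z. deriv f w * V w ^ k = B" using rep z by (simp add: represents_def)
  moreover have "\<forall>\<^sub>F w in at z. w \<in> T" using T by (rule eventually_at_in_open')
  ultimately have ev: "\<forall>\<^sub>F w in at z. deriv f w = B / V w ^ k"
    by eventually_elim (auto simp: T_def field_simps)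
  have cont1: "isCont (\<lambda>w. B / V w ^ k) z"
    using contV z nz by (auto intro!: continuous_intros simp: continuous_on_eq_continuous_at)
  show der: "(remove_sings f has_field_derivative B / V z ^ k) (at z)"
    by (rule remove_sings_has_derivative[OF mero ev cont1])
  have evf: "\<forall>\<^sub>F w in at z. f w = remove_sings f w"
    using eventually_remove_sings_eq_at[OF meromorphic_on_isolated_singularity[OF mero]]
    by eventually_elim simp
  show "sphere_value f z = Some (remove_sings f z)"
    using evf DERIV_isCont[OF der] by (rule sphere_value_eq_Some)
  show "sphere_value (deriv f) z = Some (B / V z ^ k)"
    using ev cont1 by (rule sphere_value_eq_Some)
  show "sphere_value (\<lambda>z. deriv f z / f z) z = Some (B / V z ^ k / remove_sings f z)"
    if "remove_sings f z \<noteq> 0"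
  proof (rule sphere_value_eq_Some)
    show "\<forall>\<^sub>F w in at z. deriv f w / f w = B / V w ^ k / remove_sings f w"
      using ev evf by eventually_elim simp
    show "isCont (\<lambda>w. B / V w ^ k / remove_sings f w) z"
      using cont1 DERIV_isCont[OF der] that by (rule isCont_divide)
  qed
  show "sphere_value (\<lambda>z. deriv (deriv f) z / deriv f z) z = Some (- of_nat k * deriv V z / V z)"
    if k: "k \<ge> 1"
  proof (rule sphere_value_eq_Some)
    have "deriv V holomorphic_on T" by (rule holomorphic_deriv[OF VT T(1)])
    then have "isCont (deriv V) z" "isCont V z"
      using VT T by (auto dest!: holomorphic_on_imp_continuous_on simp: continuous_on_eq_continuous_at)
    then show "isCont (\<lambda>w. - of_nat k * deriv V w / V w) z"
      using nz by (intro continuous_intros) auto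
    obtain X where X: "open X" "z \<in> X" "\<And>w. w \<in> X - {z} \<Longrightarrow> deriv f w = B / V w ^ k"
      using ev unfolding eventually_at_topological by blast
    \<comment> \<open>f' is known to equal B / V^k only off \<open>z\<close>; deleting the centre
      leaves an open set on which this formula may be differentiated.\<close>
    define Y where "Y = X \<inter> T - {z}"
    have Y: "open Y" unfolding Y_def using X T by (intro open_delete open_Int)
    have "\<forall>\<^sub>F w in at z. w \<in> Y"
      unfolding Y_def using eventually_at_in_open[of "X \<inter> T" z] X T by auto
    then show "\<forall>\<^sub>F w in at z. deriv (deriv f) w / deriv f w = - of_nat k * deriv V w / V w"
    proof eventually_elim
      case (elim w)
      have w: "w \<in> T" "V w \<noteq> 0" "deriv f w = B / V w ^ k"
        using elim X(3) by (auto simp: Y_def T_def)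
      have "((\<lambda>w. B / V w ^ k) has_field_derivative
          - (B * (of_nat k * (deriv V w * V w ^ (k - 1)))) / (V w ^ k * V w ^ k)) (at w)"
        using DERIV_divide[OF DERIV_const[of B] DERIV_power[OF holomorphic_derivI[OF VT T(1) w(1)], of k]] w(2)
        by simp
      then have "(deriv f has_field_derivative
          - (B * (of_nat k * (deriv V w * V w ^ (k - 1)))) / (V w ^ k * V w ^ k)) (at w)"
        by (rule has_field_derivative_transform_within_open[OF _ Y elim]) (use X(3) in \<open>auto simp: Y_def\<close>)
      then have D: "deriv (deriv f) w = - (B * (of_nat k * (deriv V w * V w ^ (k - 1)))) / (V w ^ k * V w ^ k)"
        by (rule DERIV_imp_deriv)
      have "V w ^ k = V w * V w ^ (k - 1)" using k by (cases k) auto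
      then show ?case unfolding D w(3) using w(2) B by (simp add: field_simps)
    qed
  qed
qed

text \<open>The common majorant gives the local bounds for Montel's theorem. The limit is not
  identically zero because Taylor coefficients at 0 converge too, and the moduli of the first
  \<open>k\<close> of them always sum to 1.\<close>

lemma normalized_solution_limit:
  fixes V :: "nat \<Rightarrow> complex \<Rightarrow> complex"
  assumes M: "M \<ge> 0" and V: "\<And>n. normalized_solution k M (V n)"
  shows "\<exists>s w. strict_mono s \<and> w holomorphic_on unit_disk \<and> (\<forall>\<^sub>\<approx>z\<in>unit_disk. w z \<noteq> 0) \<and>
           compact_limit unit_disk (\<lambda>n. V (s n)) w"
proof -
  define \<H> where "\<H> = Collect (normalized_solution k M)"
  obtain w s where w: "w holomorphic_on unit_disk" and s: "strict_mono (s :: nat \<Rightarrow> nat)"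
    and lim: "\<And>K. compact K \<Longrightarrow> K \<subseteq> unit_disk \<Longrightarrow> uniform_limit K (V \<circ> s) w sequentially"
  proof (rule Montel[of unit_disk \<H> V])
    show "open unit_disk" by simp
    show "h holomorphic_on unit_disk" if "h \<in> \<H>" for h
      using that by (simp add: \<H>_def normalized_solution_def)
    show "range V \<subseteq> \<H>" using V by (auto simp: \<H>_def)
    show "\<exists>C. \<forall>h\<in>\<H>. \<forall>z\<in>K. cmod (h z) \<le> C" if K: "compact K" "K \<subseteq> unit_disk" for K
    proof (cases "K = {}")
      case False
      \<comment> \<open>The majorant series increases with the modulus, so the point of
        \<open>K\<close> farthest from 0 bounds all of \<open>K\<close>.\<close>
      obtain z0 where z0: "z0 \<in> K" "\<And>z. z \<in> K \<Longrightarrow> cmod z \<le> cmod z0"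
        using continuous_attains_sup[OF K(1) False continuous_on_norm_id] by blast
      have z0': "cmod z0 < 1" using z0 K by auto
      show ?thesis
      proof (intro exI ballI)
        fix h z assume h: "h \<in> \<H>" and z: "z \<in> K"
        have "cmod (h z) \<le> (\<Sum>n. majorant M n * cmod z ^ n)"
          using h z K by (auto simp: \<H>_def normalized_solution_def)
        also have "\<dots> \<le> (\<Sum>n. majorant M n * cmod z0 ^ n)"
        proof (rule suminf_le)
          show "majorant M n * cmod z ^ n \<le> majorant M n * cmod z0 ^ n" for n
            using majorant_ge_1[OF M, of n] z0(2)[OF z] by (intro mult_left_mono power_mono) auto
          show "summable (\<lambda>n. majorant M n * cmod z ^ n)" "summable (\<lambda>n. majorant M n * cmod z0 ^ n)"
            using z0(2)[OF z] z0' by (auto intro!: summable_majorant M)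
        qed
        finally show "cmod (h z) \<le> (\<Sum>n. majorant M n * cmod z0 ^ n)" .
      qed
    qed auto
  qed (rule that)
  have "\<not> (\<forall>\<^sub>\<approx>z\<in>unit_disk. w z = 0)"
  proof
    assume "\<forall>\<^sub>\<approx>z\<in>unit_disk. w z = 0"
    then have ev: "\<forall>\<^sub>F z in at 0. w z = 0" by (rule eventually_cosparse_imp_eventually_at) simp
    have "isCont w 0"
      using holomorphic_on_imp_continuous_on[OF w] by (simp add: continuous_on_eq_continuous_at)
    then have "w \<midarrow>0\<rightarrow> w 0" by (rule isContD)
    moreover have "w \<midarrow>0\<rightarrow> 0" using ev by (rule tendsto_eventually)
    ultimately have "w 0 = 0" by (rule LIM_unique)
    with ev have ev0: "\<forall>\<^sub>F z in nhds 0. w z = 0" by (simp add: eventually_nhds_conv_at)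
    have d0: "(deriv ^^ j) w 0 = 0" for j
      using higher_deriv_cong_ev[OF ev0 refl, of j] by simp
    have "uniform_limit (ball 0 (1/2)) (V \<circ> s) w sequentially"
      using lim[OF compact_cball[of 0 "1/2"]] by (rule uniform_limit_on_subset) auto
    moreover have "\<forall>\<^sub>F n in sequentially. (V \<circ> s) n holomorphic_on ball 0 (1/2)"
    proof (rule always_eventually, rule allI)
      fix n
      have "V (s n) holomorphic_on unit_disk" using V by (simp add: normalized_solution_def)
      then show "(V \<circ> s) n holomorphic_on ball 0 (1/2)"
        unfolding o_def by (rule holomorphic_on_subset) auto
    qed
    ultimately have "(\<lambda>n. (deriv ^^ j) ((V \<circ> s) n) 0) \<longlonglongrightarrow> (deriv ^^ j) w 0" for j
      by (rule higher_deriv_complex_uniform_limit) auto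
    then have "(\<lambda>n. \<Sum>j<k. cmod ((deriv ^^ j) ((V \<circ> s) n) 0 / fact j)) \<longlonglongrightarrow>
        (\<Sum>j<k. cmod ((deriv ^^ j) w 0 / fact j))"
      by (intro tendsto_intros) auto
    moreover have "(\<Sum>j<k. cmod ((deriv ^^ j) ((V \<circ> s) n) 0 / fact j)) = 1" for n
      using V by (simp add: normalized_solution_def)
    ultimately show False using LIMSEQ_unique[OF tendsto_const[of "1::real"]] d0 by fastforce
  qed
  moreover have "w meromorphic_on unit_disk"
    using w by (intro analytic_on_imp_meromorphic_on) (simp add: analytic_on_open)
  ultimately have "\<forall>\<^sub>\<approx>z\<in>unit_disk. w z \<noteq> 0"
    using meromorphic_imp_constant_or_avoid[OF _ open_ball connected_ball] by blast
  then show ?thesis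
    using w s lim by (intro exI[of _ s] exI[of _ w]) (auto simp: compact_limit_def o_def)
qed

section \<open>Subsequential limits after rescaling\<close>

lemma schwarzian_family_subsequence:
  fixes f :: "nat \<Rightarrow> complex \<Rightarrow> complex"
  assumes f: "\<And>n. f n \<in> schwarzian_family k M" and k: "k \<ge> 1"
  shows "\<exists>s V B w. strict_mono s \<and> (\<forall>n. V n holomorphic_on unit_disk \<and> represents k (V n) (B n) (f (s n))) \<and>
           w holomorphic_on unit_disk \<and> (\<forall>\<^sub>\<approx>z\<in>unit_disk. w z \<noteq> 0) \<and> compact_limit unit_disk V w"
proof -
  have "\<forall>n. \<exists>V B. normalized_solution k M V \<and> represents k V B (f n)"
    using schwarzian_family_representation[OF f k] by blast
  then obtain V B where V: "\<And>n. normalized_solution k M (V n)" and rep: "\<And>n. represents k (V n) (B n) (f n)"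
    by metis
  \<comment> \<open>M >= 0 comes from the mere existence of a member of the family.\<close>
  have "0 \<le> cmod (remove_sings (S_aux k (k + 1) (f 0)) 0)" by simp
  also have "\<dots> \<le> M" using schwarzian_family_bound[OF f, of 0] by (simp del: S_aux.simps)
  finally have "0 \<le> M" .
  then obtain s w where s: "strict_mono s" "w holomorphic_on unit_disk" "\<forall>\<^sub>\<approx>z\<in>unit_disk. w z \<noteq> 0"
      "compact_limit unit_disk (\<lambda>n. V (s n)) w"
    using normalized_solution_limit[where V = V and k = k, OF _ V] by meson
  have "\<forall>n. V (s n) holomorphic_on unit_disk \<and> represents k (V (s n)) (B (s n)) (f (s n))"
    using V rep by (simp add: normalized_solution_def)
  then show ?thesis
    using s by (intro exI[of _ s] exI[of _ "\<lambda>n. V (s n)"] exI[of _ "\<lambda>n. B (s n)"] exI[of _ w] conjI)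
qed

text \<open>\<open>G\<close> is meromorphic across the zeros of \<open>w\<close>, so the identity
  theorem applies on all of \<open>D\<close>. If \<alpha> + \<beta> G vanished identically, its
  derivative \<beta> / w^k would too, forcing \<beta> = 0 and then \<alpha> = 0.\<close>

lemma affine_of_primitive_not_identically_zero:
  assumes D: "open D" "connected D" and w: "w holomorphic_on D" "\<forall>\<^sub>\<approx>z\<in>D. w z \<noteq> 0"
    and G: "\<And>z. z \<in> {z \<in> D. w z \<noteq> 0} \<Longrightarrow> (G has_field_derivative 1 / w z ^ k) (at z)"
    and ne: "D \<noteq> {}" and ab: "\<alpha> \<noteq> 0 \<or> \<beta> \<noteq> 0"
  shows "\<forall>\<^sub>\<approx>z\<in>D. \<alpha> + \<beta> * G z \<noteq> 0"
proof -
  define U where "U = {z \<in> D. w z \<noteq> 0}"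
  have U: "open U" unfolding U_def by (rule no_accumulation_of_cosparse[OF D(1) w(2)])
  have wmero: "w meromorphic_on D"
    using w(1) by (intro analytic_on_imp_meromorphic_on) (simp add: analytic_on_open D)
  have evU: "\<forall>\<^sub>F z in at e. z \<in> U" if e: "e \<in> D" for e
  proof -
    have "\<forall>\<^sub>F z in at e. w z \<noteq> 0" using w(2) e by (rule eventually_cosparse_imp_eventually_at)
    moreover have "\<forall>\<^sub>F z in at e. z \<in> D" using D(1) e by (rule eventually_at_in_open')
    ultimately show ?thesis by eventually_elim (simp add: U_def)
  qed
  have "G meromorphic_on {e}" if e: "e \<in> D" for e
  proof -
    obtain X where X: "open X" "e \<in> X" "\<And>z. z \<in> X - {e} \<Longrightarrow> z \<in> U"
      using evU[OF e] unfolding eventually_at_topological by blast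
    obtain r where r: "r > 0" "ball e r \<subseteq> X" using X open_contains_ball by blast
    show ?thesis
    proof (rule primitive_meromorphic_at[OF r(1)])
      show "(G has_field_derivative 1 / w z ^ k) (at z)" if "z \<in> ball e r - {e}" for z
        using that X(3) r(2) by (intro G) (auto simp: U_def)
      have "w meromorphic_on {e}" using wmero e by (auto intro: meromorphic_on_subset)
      then show "(\<lambda>z. 1 / w z ^ k) meromorphic_on {e}" by (intro meromorphic_intros)
      have "\<forall>\<^sub>F z in at e. 1 / w z ^ k \<noteq> 0"
        using evU[OF e] by eventually_elim (simp add: U_def)
      then show "\<exists>\<^sub>F z in at e. 1 / w z ^ k \<noteq> 0" by (rule eventually_frequently[OF at_neq_bot])
    qed
  qed
  then have "G meromorphic_on D" using meromorphic_on_meromorphic_at by blast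
  then have mero: "(\<lambda>z. \<alpha> + \<beta> * G z) meromorphic_on D" by (intro meromorphic_intros)
  have "\<not> (\<forall>\<^sub>\<approx>z\<in>D. \<alpha> + \<beta> * G z = 0)"
  proof
    assume zero: "\<forall>\<^sub>\<approx>z\<in>D. \<alpha> + \<beta> * G z = 0"
    obtain e where e: "e \<in> D" using ne by blast
    obtain z where z: "z \<in> U"
      using eventually_happens[OF evU[OF e]] by auto
    then have zD: "z \<in> D" by (simp add: U_def)
    have der: "((\<lambda>z. \<alpha> + \<beta> * G z) has_field_derivative \<beta> * (1 / w z ^ k)) (at z)"
      using G z by (auto intro!: derivative_eq_intros simp: U_def)
    have ev: "\<forall>\<^sub>F y in at z. \<alpha> + \<beta> * G y = 0"
      using zero zD by (rule eventually_cosparse_imp_eventually_at)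
    have "(\<lambda>z. \<alpha> + \<beta> * G z) \<midarrow>z\<rightarrow> \<alpha> + \<beta> * G z"
      using DERIV_isCont[OF der] by (rule isContD)
    moreover have "(\<lambda>z. \<alpha> + \<beta> * G z) \<midarrow>z\<rightarrow> 0" using ev by (rule tendsto_eventually)
    ultimately have z0: "\<alpha> + \<beta> * G z = 0" by (rule LIM_unique)
    with ev have ev': "\<forall>\<^sub>F y in nhds z. \<alpha> + \<beta> * G y = 0" by (simp add: eventually_nhds_conv_at)
    have "((\<lambda>_. 0) has_field_derivative \<beta> * (1 / w z ^ k)) (at z)"
      using der DERIV_cong_ev[OF refl ev' refl] by blast
    then have "\<beta> * (1 / w z ^ k) = 0" using DERIV_unique DERIV_const by blast
    then have "\<beta> = 0" using z by (simp add: U_def)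
    with z0 ab show False by simp
  qed
  then show ?thesis using meromorphic_imp_constant_or_avoid[OF mero D, of 0] by blast
qed

text \<open>Shape and size are separated: (f - A) / B has value 0 at \<open>a\<close> and derivative
  1 / V^k, so it converges whatever \<open>A\<close> and \<open>B\<close> do, and f / N = A / N + (B
  / N) G follows. Poles may cluster at the zeros of \<open>w\<close>, zeros of f at those of
  \<open>h\<close>; both belong to \<open>E\<close>.\<close>

lemma schwarzian_family_scaled_limit:
  fixes f :: "nat \<Rightarrow> complex \<Rightarrow> complex"
  assumes f: "\<And>n. f n \<in> schwarzian_family k M" and k: "k \<ge> 1"
  shows "\<exists>s V B w E N h \<beta>. strict_mono s \<and> no_accumulation_in E unit_disk \<and> open (unit_disk - E) \<and>
     (\<forall>n. V n holomorphic_on unit_disk \<and> represents k (V n) (B n) (f (s n)) \<and> N n > 0) \<and>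
     w holomorphic_on unit_disk \<and> compact_limit unit_disk V w \<and>
     (\<lambda>n. B n / complex_of_real (N n)) \<longlonglongrightarrow> \<beta> \<and>
     compact_limit (unit_disk - E) (\<lambda>n z. remove_sings (f (s n)) z / complex_of_real (N n)) h \<and>
     continuous_on (unit_disk - E) h \<and> (\<forall>z\<in>unit_disk - E. w z \<noteq> 0 \<and> h z \<noteq> 0) \<and>
     (convergent N \<or> filterlim N at_top sequentially)"
proof -
  obtain s V B w where s: "strict_mono s" and V: "\<And>n. V n holomorphic_on unit_disk"
    and rep: "\<And>n. represents k (V n) (B n) (f (s n))"
    and w: "w holomorphic_on unit_disk" "\<forall>\<^sub>\<approx>z\<in>unit_disk. w z \<noteq> 0" and lim: "compact_limit unit_disk V w"
    using schwarzian_family_subsequence[of f, OF f k] by blast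
  define U where "U = {z \<in> unit_disk. w z \<noteq> 0}"
  have U: "open U" "connected U" unfolding U_def
    using no_accumulation_of_cosparse(2,3)[OF open_ball w(2)] by simp_all
  have UD: "U \<subseteq> unit_disk" by (auto simp: U_def)
  have contw: "continuous_on U w"
    using holomorphic_on_imp_continuous_on[OF w(1)] UD by (rule continuous_on_subset)
  have wU: "w z \<noteq> 0" if "z \<in> U" for z using that by (simp add: U_def)
  have limU: "compact_limit U V w" using lim UD by (rule compact_limit_subset)
  obtain a where a: "a \<in> U"
  proof -
    have "\<forall>\<^sub>F z in at 0. w z \<noteq> 0" using w(2) by (rule eventually_cosparse_imp_eventually_at) simp
    moreover have "\<forall>\<^sub>F z in at (0::complex). z \<in> unit_disk" by (rule eventually_at_in_open') auto
    ultimately have "\<forall>\<^sub>F z in at 0. z \<in> U" by eventually_elim (simp add: U_def)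
    then show ?thesis using eventually_happens that by force
  qed
  define F where "F = (\<lambda>n. remove_sings (f (s n)))"
  \<comment> \<open>Since \<open>w\<close> is non-zero at \<open>a\<close>, so is \<open>V n\<close>
    eventually, and \<open>A n\<close> is then a genuine finite value of the function.\<close>
  define A where "A = (\<lambda>n. F n a)"
  have B: "B n \<noteq> 0" for n using rep by (simp add: represents_def)
  define G where "G = (\<lambda>n z. (F n z - A n) / B n)"
  have der: "\<forall>\<^sub>F n in sequentially. \<forall>z\<in>K. (G n has_field_derivative 1 / V n z ^ k) (at z)"
    if K: "compact K" "K \<subseteq> U" for K
  proof -
    have "\<forall>\<^sub>F n in sequentially. \<forall>z\<in>K. V n z \<noteq> 0"
      by (rule compact_limit_eventually_nonzero[OF limU contw wU K])
    then show ?thesis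
    proof eventually_elim
      case (elim n)
      show ?case
      proof
        fix z assume z: "z \<in> K"
        have "(F n has_field_derivative B n / V n z ^ k) (at z)"
          unfolding F_def using z K UD elim by (intro represents_values(1)[OF rep V]) auto
        from DERIV_cdivide[OF DERIV_diff[OF this DERIV_const], of "A n" "B n"]
        show "(G n has_field_derivative 1 / V n z ^ k) (at z)"
          using B[of n] by (simp add: G_def)
      qed
    qed
  qed
  have limg: "compact_limit U (\<lambda>n z. 1 / V n z ^ k) (\<lambda>z. 1 / w z ^ k)"
    by (intro compact_limit_divide compact_limit_const compact_limit_power limU contw continuous_intros tendsto_const)
      (simp add: wU)
  have contg: "continuous_on U (\<lambda>z. 1 / w z ^ k)"
    by (intro continuous_intros contw) (simp add: wU)
  have Ga: "(\<lambda>n. G n a) \<longlonglongrightarrow> 0" by (simp add: G_def A_def)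
  obtain G' where G': "compact_limit U G G'" "\<And>z. z \<in> U \<Longrightarrow> (G' has_field_derivative 1 / w z ^ k) (at z)"
    using compact_limit_primitives[OF U a Ga limg contg der] by blast
  define N where "N = (\<lambda>n. norm (A n, B n))"
  obtain t \<alpha> \<beta> where t: "strict_mono t" and A: "(\<lambda>n. A (t n) / of_real (N (t n))) \<longlonglongrightarrow> \<alpha>"
    and Bl: "(\<lambda>n. B (t n) / of_real (N (t n))) \<longlonglongrightarrow> \<beta>" and ab: "\<alpha> \<noteq> 0 \<or> \<beta> \<noteq> 0"
    and N: "convergent (\<lambda>n. N (t n)) \<or> filterlim (\<lambda>n. N (t n)) at_top sequentially"
    using normalized_subsequence[of B A, OF B] unfolding N_def by blast
  have Npos: "N n > 0" for n using B[of n] by (simp add: N_def zero_prod_def)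
  define h where "h = (\<lambda>z. \<alpha> + \<beta> * G' z)"
  have hz: "\<forall>\<^sub>\<approx>z\<in>unit_disk. h z \<noteq> 0"
    unfolding h_def using G'(2) ab
    by (intro affine_of_primitive_not_identically_zero[OF open_ball connected_ball w]) (auto simp: U_def)
  with w(2) have wh: "\<forall>\<^sub>\<approx>z\<in>unit_disk. w z \<noteq> 0 \<and> h z \<noteq> 0" by eventually_elim simp
  define E where "E = {z \<in> unit_disk. \<not> (w z \<noteq> 0 \<and> h z \<noteq> 0)}"
  have DE: "unit_disk - E = {z \<in> unit_disk. w z \<noteq> 0 \<and> h z \<noteq> 0}" by (auto simp: E_def)
  have E: "no_accumulation_in E unit_disk" "open (unit_disk - E)"
    unfolding DE unfolding E_def by (rule no_accumulation_of_cosparse[OF open_ball wh])+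
  have EU: "unit_disk - E \<subseteq> U" by (auto simp: E_def U_def)
  have contG: "continuous_on U G'"
    using G'(2) by (intro continuous_at_imp_continuous_on ballI DERIV_isCont)
  have "compact_limit U (\<lambda>n z. A (t n) / of_real (N (t n)) + B (t n) / of_real (N (t n)) * G (t n) z) h"
    unfolding h_def
    by (intro compact_limit_add compact_limit_mult compact_limit_const A Bl contG continuous_on_const
        compact_limit_subseq[OF G'(1) t])
  moreover have "A n / of_real (N n) + B n / of_real (N n) * G n z = F n z / of_real (N n)" for n z
    using B[of n] Npos[of n] by (simp add: G_def field_simps)
  ultimately have "compact_limit U (\<lambda>n z. F (t n) z / of_real (N (t n))) h" by simp
  then have limh: "compact_limit (unit_disk - E) (\<lambda>n z. F (t n) z / of_real (N (t n))) h"
    using EU by (rule compact_limit_subset)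
  have conth: "continuous_on (unit_disk - E) h"
    unfolding h_def using contG EU by (intro continuous_intros) (rule continuous_on_subset)
  show ?thesis
  proof (rule exI[of _ "\<lambda>n. s (t n)"], rule exI[of _ "\<lambda>n. V (t n)"], rule exI[of _ "\<lambda>n. B (t n)"],
      rule exI[of _ w], rule exI[of _ E], rule exI[of _ "\<lambda>n. N (t n)"], rule exI[of _ h], rule exI[of _ \<beta>],
      intro conjI)
    show "strict_mono (\<lambda>n. s (t n))" using s t by (auto simp: strict_mono_def)
    show "\<forall>n. V (t n) holomorphic_on unit_disk \<and> represents k (V (t n)) (B (t n)) (f (s (t n))) \<and> N (t n) > 0"
      using V rep Npos by blast
    show "compact_limit unit_disk (\<lambda>n. V (t n)) w" by (rule compact_limit_subseq[OF lim t])
    show "compact_limit (unit_disk - E) (\<lambda>n z. remove_sings (f (s (t n))) z / complex_of_real (N (t n))) h"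
      using limh by (simp add: F_def)
    show "\<forall>z\<in>unit_disk - E. w z \<noteq> 0 \<and> h z \<noteq> 0" by (auto simp: E_def)
  qed (use E w Bl N conth in auto)
qed

section \<open>The four families\<close>

lemma limits_second_over_first_derivative:
  assumes "k \<ge> 1"
  shows "finite_subsequential_limits (schwarzian_family k M) (\<lambda>f z. deriv (deriv f) z / deriv f z) unit_disk"
  unfolding finite_subsequential_limits_def
proof (intro allI impI)
  fix f :: "nat \<Rightarrow> complex \<Rightarrow> complex" assume "\<forall>n. f n \<in> schwarzian_family k M"
  then have f: "\<And>n. f n \<in> schwarzian_family k M" by blast
  obtain s V B w where s: "strict_mono s" and V: "\<And>n. V n holomorphic_on unit_disk"
    and rep: "\<And>n. represents k (V n) (B n) (f (s n))"
    and w: "w holomorphic_on unit_disk" "\<forall>\<^sub>\<approx>z\<in>unit_disk. w z \<noteq> 0" and lim: "compact_limit unit_disk V w"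
    using schwarzian_family_subsequence[of f, OF f assms] by blast
  define E where "E = {z \<in> unit_disk. \<not> w z \<noteq> 0}"
  have DE: "unit_disk - E = {z \<in> unit_disk. w z \<noteq> 0}" by (auto simp: E_def)
  have E: "no_accumulation_in E unit_disk" "open (unit_disk - E)"
    unfolding DE unfolding E_def by (rule no_accumulation_of_cosparse[OF open_ball w(2)])+
  have sub: "unit_disk - E \<subseteq> unit_disk" by auto
  have cont: "continuous_on (unit_disk - E) w" "continuous_on (unit_disk - E) (deriv w)"
    using holomorphic_on_imp_continuous_on[OF w(1)] holomorphic_on_imp_continuous_on[OF holomorphic_deriv[OF w(1) open_ball]]
    by (auto intro: continuous_on_subset)
  have lims: "compact_limit (unit_disk - E) V w" "compact_limit (unit_disk - E) (\<lambda>n. deriv (V n)) (deriv w)"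
    using compact_limit_subset[OF lim sub] compact_limit_subset[OF compact_limit_deriv[OF open_ball V w(1) lim] sub] by auto
  have nz: "w z \<noteq> 0" if "z \<in> unit_disk - E" for z using that by (simp add: DE)
  have "compact_limit (unit_disk - E) (\<lambda>n z. - of_nat k * deriv (V n) z / V n z) (\<lambda>z. - of_nat k * deriv w z / w z)"
    by (intro compact_limit_divide compact_limit_mult compact_limit_const lims cont continuous_intros tendsto_const nz)
  moreover have "\<forall>\<^sub>F n in sequentially. \<forall>z\<in>K.
      sphere_value (\<lambda>z. deriv (deriv (f (s n))) z / deriv (f (s n)) z) z = Some (- of_nat k * deriv (V n) z / V n z)"
    if K: "compact K" "K \<subseteq> unit_disk - E" for K
  proof -
    have "\<forall>\<^sub>F n in sequentially. \<forall>z\<in>K. V n z \<noteq> 0"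
      by (rule compact_limit_eventually_nonzero[OF lims(1) cont(1) nz K])
    then show ?thesis
    proof eventually_elim
      case (elim n)
      then show ?case using K(2) by (intro ballI represents_values(4)[OF rep V _ _ assms]) auto
    qed
  qed
  ultimately show "\<exists>s E F g. strict_mono s \<and> no_accumulation_in E unit_disk \<and> open (unit_disk - E) \<and>
       compact_limit (unit_disk - E) F g \<and>
       (\<forall>K. compact K \<longrightarrow> K \<subseteq> unit_disk - E \<longrightarrow> (\<forall>\<^sub>F n in sequentially. \<forall>z\<in>K.
         sphere_value (\<lambda>z. deriv (deriv (f (s n))) z / deriv (f (s n)) z) z = Some (F n z)))"
    using s E by blast
qed

text \<open>Dividing numerator and denominator by \<open>N n\<close> replaces possibly divergent
  data by convergent ones. The limit \<beta> / (w^k h) is finite because \<open>h\<close> has no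
  zeros off \<open>E\<close>; it is identically 0 if \<beta> = 0.\<close>

lemma limits_logarithmic_derivative:
  assumes "k \<ge> 1"
  shows "finite_subsequential_limits (schwarzian_family k M) (\<lambda>f z. deriv f z / f z) unit_disk"
  unfolding finite_subsequential_limits_def
proof (intro allI impI)
  fix f :: "nat \<Rightarrow> complex \<Rightarrow> complex" assume "\<forall>n. f n \<in> schwarzian_family k M"
  then have f: "\<And>n. f n \<in> schwarzian_family k M" by blast
  obtain s V B w E N h \<beta> where s: "strict_mono s" and E: "no_accumulation_in E unit_disk" "open (unit_disk - E)"
    and V: "\<And>n. V n holomorphic_on unit_disk" and rep: "\<And>n. represents k (V n) (B n) (f (s n))"
    and N: "\<And>n. N n > 0" and w: "w holomorphic_on unit_disk" and lim: "compact_limit unit_disk V w"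
    and \<beta>: "(\<lambda>n. B n / complex_of_real (N n)) \<longlonglongrightarrow> \<beta>"
    and limh: "compact_limit (unit_disk - E) (\<lambda>n z. remove_sings (f (s n)) z / complex_of_real (N n)) h"
    and conth: "continuous_on (unit_disk - E) h" and nz: "\<And>z. z \<in> unit_disk - E \<Longrightarrow> w z \<noteq> 0 \<and> h z \<noteq> 0"
    using schwarzian_family_scaled_limit[of f, OF f assms] by blast
  have contw: "continuous_on (unit_disk - E) w"
    using holomorphic_on_imp_continuous_on[OF w] by (rule continuous_on_subset) auto
  have limw: "compact_limit (unit_disk - E) V w" using lim by (rule compact_limit_subset) auto
  define Q where "Q = (\<lambda>n z. B n / of_real (N n) / V n z ^ k / (remove_sings (f (s n)) z / of_real (N n)))"
  have "compact_limit (unit_disk - E) Q (\<lambda>z. \<beta> / w z ^ k / h z)"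
    unfolding Q_def
    by (intro compact_limit_divide compact_limit_power compact_limit_const limh limw conth contw \<beta> continuous_intros)
      (use nz in auto)
  moreover have "\<forall>\<^sub>F n in sequentially. \<forall>z\<in>K. sphere_value (\<lambda>z. deriv (f (s n)) z / f (s n) z) z = Some (Q n z)"
    if K: "compact K" "K \<subseteq> unit_disk - E" for K
  proof -
    have "\<forall>\<^sub>F n in sequentially. \<forall>z\<in>K. V n z \<noteq> 0"
      by (rule compact_limit_eventually_nonzero[OF limw contw _ K]) (use nz in auto)
    moreover have "\<forall>\<^sub>F n in sequentially. \<forall>z\<in>K. remove_sings (f (s n)) z / of_real (N n) \<noteq> 0"
      by (rule compact_limit_eventually_nonzero[OF limh conth _ K]) (use nz in auto)
    ultimately show ?thesis
    proof eventually_elim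
      case (elim n)
      show ?case
      proof
        fix z assume z: "z \<in> K"
        have "Q n z = B n / V n z ^ k / remove_sings (f (s n)) z"
          using N[of n] by (simp add: Q_def field_simps)
        then show "sphere_value (\<lambda>z. deriv (f (s n)) z / f (s n) z) z = Some (Q n z)"
          using represents_values(5)[OF rep V, of z n] elim z K(2) by auto
      qed
    qed
  qed
  ultimately show "\<exists>s E F g. strict_mono s \<and> no_accumulation_in E unit_disk \<and> open (unit_disk - E) \<and>
       compact_limit (unit_disk - E) F g \<and>
       (\<forall>K. compact K \<longrightarrow> K \<subseteq> unit_disk - E \<longrightarrow> (\<forall>\<^sub>F n in sequentially. \<forall>z\<in>K.
         sphere_value (\<lambda>z. deriv (f (s n)) z / f (s n) z) z = Some (F n z)))"
    using s E by blast
qed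

lemma quasi_normal_derivative:
  assumes "k \<ge> 1"
  shows "quasi_normal_on {deriv f | f. f \<in> schwarzian_family k M} unit_disk"
proof (rule quasi_normal_on_image)
  show "deriv f meromorphic_on unit_disk" if "f \<in> schwarzian_family k M" for f
    using that by (auto simp: schwarzian_family_def intro: meromorphic_on_deriv)
  fix f :: "nat \<Rightarrow> complex \<Rightarrow> complex" assume f: "\<And>n. f n \<in> schwarzian_family k M"
  obtain s V B w where s: "strict_mono s" and V: "\<And>n. V n holomorphic_on unit_disk"
    and rep: "\<And>n. represents k (V n) (B n) (f (s n))"
    and w: "w holomorphic_on unit_disk" "\<forall>\<^sub>\<approx>z\<in>unit_disk. w z \<noteq> 0" and lim: "compact_limit unit_disk V w"
    using schwarzian_family_subsequence[of f, OF f assms] by blast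
  have B: "B n \<noteq> 0" for n using rep by (simp add: represents_def)
  \<comment> \<open>Taking 0 for the first component turns the norm into |B|; then \<alpha> = 0, so
    \<beta> is non-zero and the limit \<beta> / w^k has no zeros.\<close>
  obtain t \<alpha> \<beta> where t: "strict_mono t" and "(\<lambda>n. 0 / complex_of_real (norm (0::complex, B (t n)))) \<longlonglongrightarrow> \<alpha>"
    and \<beta>: "(\<lambda>n. B (t n) / of_real (norm (0::complex, B (t n)))) \<longlonglongrightarrow> \<beta>" and "\<alpha> \<noteq> 0 \<or> \<beta> \<noteq> 0"
    and N: "convergent (\<lambda>n. norm (0::complex, B (t n))) \<or> filterlim (\<lambda>n. norm (0::complex, B (t n))) at_top sequentially"
    using normalized_subsequence[of B "\<lambda>_. 0", OF B] by blast
  then have "\<beta> \<noteq> 0" using LIMSEQ_unique[OF tendsto_const[of "0::complex"]] by auto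
  define E where "E = {z \<in> unit_disk. \<not> w z \<noteq> 0}"
  have DE: "unit_disk - E = {z \<in> unit_disk. w z \<noteq> 0}" by (auto simp: E_def)
  have E: "no_accumulation_in E unit_disk" "open (unit_disk - E)"
    unfolding DE unfolding E_def by (rule no_accumulation_of_cosparse[OF open_ball w(2)])+
  have cont: "continuous_on (unit_disk - E) w"
    using holomorphic_on_imp_continuous_on[OF w(1)] by (rule continuous_on_subset) auto
  have limV: "compact_limit (unit_disk - E) (\<lambda>n. V (t n)) w"
    using compact_limit_subseq[OF lim t] by (rule compact_limit_subset) auto
  have nz: "w z \<noteq> 0" if "z \<in> unit_disk - E" for z using that by (simp add: DE)
  have "\<exists>g. spherical_locally_uniform_limit (unit_disk - E) (\<lambda>n. sphere_value (deriv (f (s (t n))))) g"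
  proof (rule spherical_limit_scaled[OF E(2) _ _ _ N])
    show "compact_limit (unit_disk - E) (\<lambda>n z. B (t n) / of_real (norm (0::complex, B (t n))) / V (t n) z ^ k)
        (\<lambda>z. \<beta> / w z ^ k)"
      by (intro compact_limit_divide compact_limit_power compact_limit_const limV cont \<beta> continuous_intros)
        (use nz in auto)
    show "continuous_on (unit_disk - E) (\<lambda>z. \<beta> / w z ^ k)"
      by (intro continuous_intros cont) (use nz in auto)
    show "\<beta> / w z ^ k \<noteq> 0" if "z \<in> unit_disk - E" for z
      using nz[OF that] \<open>\<beta> \<noteq> 0\<close> by simp
    show "\<forall>\<^sub>F n in sequentially. \<forall>z\<in>K. sphere_value (deriv (f (s (t n)))) z =
        Some (of_real (norm (0::complex, B (t n))) * (B (t n) / of_real (norm (0::complex, B (t n))) / V (t n) z ^ k))"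
      if K: "compact K" "K \<subseteq> unit_disk - E" for K
    proof -
      have "\<forall>\<^sub>F n in sequentially. \<forall>z\<in>K. V (t n) z \<noteq> 0"
        by (rule compact_limit_eventually_nonzero[OF limV cont nz K])
      then show ?thesis
      proof eventually_elim
        case (elim n)
        show ?case
        proof
          fix z assume z: "z \<in> K"
          have "norm (0::complex, B (t n)) \<noteq> 0" using B by (simp add: zero_prod_def)
          then show "sphere_value (deriv (f (s (t n)))) z =
              Some (of_real (norm (0::complex, B (t n))) * (B (t n) / of_real (norm (0::complex, B (t n))) / V (t n) z ^ k))"
            using represents_values(3)[OF rep V, of z "t n"] elim z K(2) by auto
        qed
      qed
    qed
  qed
  moreover have "strict_mono (\<lambda>n. s (t n))" using s t by (auto simp: strict_mono_def)
  ultimately show "\<exists>s E g. strict_mono s \<and> no_accumulation_in E unit_disk \<and>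
      spherical_locally_uniform_limit (unit_disk - E) (\<lambda>n. sphere_value (deriv (f (s n)))) g"
    using E(1) by blast
qed

text \<open>f is the scale \<open>N n\<close> times a function with zero-free limit off
  \<open>E\<close>, so the alternative for \<open>N\<close> decides between a finite limit and
  infinity.\<close>

lemma quasi_normal_schwarzian_family:
  assumes "k \<ge> 1"
  shows "quasi_normal_on (schwarzian_family k M) unit_disk"
proof -
  have "quasi_normal_on {f | f. f \<in> schwarzian_family k M} unit_disk"
  proof (rule quasi_normal_on_image)
    show "f meromorphic_on unit_disk" if "f \<in> schwarzian_family k M" for f
      using that by (simp add: schwarzian_family_def)
    fix f :: "nat \<Rightarrow> complex \<Rightarrow> complex" assume f: "\<And>n. f n \<in> schwarzian_family k M"
    obtain s V B w E N h \<beta> where s: "strict_mono s" and E: "no_accumulation_in E unit_disk" "open (unit_disk - E)"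
      and V: "\<And>n. V n holomorphic_on unit_disk" and rep: "\<And>n. represents k (V n) (B n) (f (s n))"
      and Npos: "\<And>n. N n > 0" and w: "w holomorphic_on unit_disk" and lim: "compact_limit unit_disk V w"
      and limh: "compact_limit (unit_disk - E) (\<lambda>n z. remove_sings (f (s n)) z / complex_of_real (N n)) h"
      and conth: "continuous_on (unit_disk - E) h" and nz: "\<And>z. z \<in> unit_disk - E \<Longrightarrow> w z \<noteq> 0 \<and> h z \<noteq> 0"
      and N: "convergent N \<or> filterlim N at_top sequentially"
      using schwarzian_family_scaled_limit[of f, OF f assms] by blast
    have contw: "continuous_on (unit_disk - E) w"
      using holomorphic_on_imp_continuous_on[OF w] by (rule continuous_on_subset) auto
    have limw: "compact_limit (unit_disk - E) V w" using lim by (rule compact_limit_subset) auto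
    have "\<exists>g. spherical_locally_uniform_limit (unit_disk - E) (\<lambda>n. sphere_value (f (s n))) g"
    proof (rule spherical_limit_scaled[OF E(2) limh conth _ N])
      show "h z \<noteq> 0" if "z \<in> unit_disk - E" for z using nz[OF that] by simp
      fix K assume K: "compact K" "K \<subseteq> unit_disk - E"
      have "\<forall>\<^sub>F n in sequentially. \<forall>z\<in>K. V n z \<noteq> 0"
        by (rule compact_limit_eventually_nonzero[OF limw contw _ K]) (use nz in auto)
      then show "\<forall>\<^sub>F n in sequentially. \<forall>z\<in>K. sphere_value (f (s n)) z =
          Some (complex_of_real (N n) * (remove_sings (f (s n)) z / complex_of_real (N n)))"
      proof eventually_elim
        case (elim n)
        show ?case
        proof
          fix z assume z: "z \<in> K"
          show "sphere_value (f (s n)) z =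
              Some (complex_of_real (N n) * (remove_sings (f (s n)) z / complex_of_real (N n)))"
            using represents_values(2)[OF rep V, of z n] elim z K(2) Npos[of n] by auto
        qed
      qed
    qed
    then show "\<exists>s E g. strict_mono s \<and> no_accumulation_in E unit_disk \<and>
        spherical_locally_uniform_limit (unit_disk - E) (\<lambda>n. sphere_value (f (s n))) g"
      using s E(1) by blast
  qed
  then show ?thesis by simp
qed

theorem theorem1p2:
  fixes k :: nat and M :: real
  assumes "k \<ge> 1"
  shows
    "(quasi_normal_on {\<lambda>z. deriv (deriv f) z / deriv f z | f. f \<in> schwarzian_family k M} unit_disk \<and>
      (\<nexists>F. range F \<subseteq> {\<lambda>z. deriv (deriv f) z / deriv f z | f. f \<in> schwarzian_family k M} \<and>
           converges_to_infinity_on F unit_disk)) \<and>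
     (quasi_normal_on {\<lambda>z. deriv f z / f z | f. f \<in> schwarzian_family k M} unit_disk \<and>
      (\<nexists>F. range F \<subseteq> {\<lambda>z. deriv f z / f z | f. f \<in> schwarzian_family k M} \<and>
           converges_to_infinity_on F unit_disk)) \<and>
     quasi_normal_on {deriv f | f. f \<in> schwarzian_family k M} unit_disk \<and>
     quasi_normal_on (schwarzian_family k M) unit_disk"
proof -
  have mero: "f meromorphic_on unit_disk" if "f \<in> schwarzian_family k M" for f
    using that by (simp add: schwarzian_family_def)
  have "(\<lambda>z. deriv (deriv f) z / deriv f z) meromorphic_on unit_disk"
    "(\<lambda>z. deriv f z / f z) meromorphic_on unit_disk" if "f \<in> schwarzian_family k M" for f
    using mero[OF that] by (auto intro!: meromorphic_intros)
  then show ?thesis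
    by (intro conjI[OF _ conjI[OF _ conjI]] quasi_normal_derivative quasi_normal_schwarzian_family assms
        finite_subsequential_limits_quasi_normal limits_second_over_first_derivative
        limits_logarithmic_derivative open_ball) auto
qed

end
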